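(* The MTL-model checking problem for parametric timed automata is undecidable, even when restricted to inputs in which the parametric timed automaton uses only one clock and one parameter and is deterministic. That is, there is no algorithm which, given a deterministic parametric timed automaton $\mathcal{A}$ with exactly one clock and exactly one parameter and an MTL formula $\varphi$, decides whether there exists a parameter valuation $v$ such that every timed word $w\in L_v(\mathcal{A})$ satisfies $w\models\varphi$.
   Context: Fix a finite alphabet $\Sigma$, a finite set $\mathcal{P}$ of parameters and a finite set $\mathcal{X}$ of clocks. A clock constraint over $\mathcal{X},\mathcal{P}$ is a finite conjunction of atoms $x\sim c$ with $x\in\mathcal{X}$, $c\in\mathbb{N}\cup\mathcal{P}$, $\sim\in\{<,\le,=,\ge,>\}$. A clock valuation is a map $\nu:\mathcal{X}\to\mathbb{R}_{\ge0}$; a parameter valuation is a map $v:\mathcal{P}\to\mathbb{Q}_{\ge0}$. $(\nu,v)\models\phi$ means $\phi$ is true after replacing each clock $x$ by $\nu(x)$ and each parameter $p$ by $v(p)$. For $\delta\ge0$, $(\nu+\delta)(x)=\nu(x)+\delta$; for $\lambda\subseteq\mathcal{X}$, $\nu[\lambda:=0]$ sets clocks in $\lambda$ to $0$ and leaves others unchanged. A parametric timed automaton is $\mathcal{A}=(\Sigma,\mathcal{L},\mathcal{L}_0,\mathcal{X},\mathcal{P},E,\mathcal{L}_F)$ with finite set of locations $\mathcal{L}$, initial locations $\mathcal{L}_0\subseteq\mathcal{L}$, final locations $\mathcal{L}_F\subseteq\mathcal{L}$, and a finite set of edges $E\subseteq\mathcal{L}\times\Sigma\times\Phi\times2^{\mathcal{X}}\times\mathcal{L}$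 ($\Phi$ the clock constraints). For a parameter valuation $v$, $\langle(l,\nu),(a,\delta),(l',\nu')\rangle$ is a $v$-transition iff there is an edge $(l,a,\phi,\lambda,l')\in E$ with $(\nu+\delta,v)\models\phi$ and $\nu'=(\nu+\delta)[\lambda:=0]$. A successful $v$-run is a finite sequence of $v$-transitions $\langle(l_{i-1},\nu_{i-1}),(a_i,\delta_i),(l_i,\nu_i)\rangle$, $1\le i\le k$, with $l_0\in\mathcal{L}_0$, $\nu_0\equiv0$, $l_k\in\mathcal{L}_F$; its associated timed word is $(a_1,t_1)\dots(a_k,t_k)$ with $t_i=\delta_1+\dots+\delta_i$. $L_v(\mathcal{A})$ is the set of timed words associated with successful $v$-runs. $\mathcal{A}$ is deterministic if $\mathcal{L}_0$ is a singleton and for any two distinct edges $(l,a,\phi_1,\lambda_1,l_1),(l,a,\phi_2,\lambda_2,l_2)$ with the same source and letter, no clock valuation and parameter valuation satisfy $\phi_1\wedge\phi_2$. A timed word is a nonempty finite sequence $(a_1,t_1)\dots(a_n,t_n)\in(\Sigma\times\mathbb{R}_{\ge0})^+$ with $t_1\le\dots\le t_n$. MTL formulas: $\varphi::=a\mid\neg\varphi\mid\varphi_1\wedge\varphi_2\mid\varphi_1\mathsf{U}_I\varphi_2$ with $a\in\Sigma$ and $I\subseteq\mathbb{R}_{\ge0}$ an open, closed or half-open interval with endpoints in $\mathbb{N}\cup\{\infty\}$ (no parameters). Pointwise semantics for $w=(a_1,t_1)\dots(a_n,t_n)$, $1\le i\le n$: $(w,i)\models a$ iff $a_i=a$; boolean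 connectives as usual; $(w,i)\models\varphi_1\mathsf{U}_I\varphi_2$ iff there is $j$ with $i<j\le n$, $(w,j)\models\varphi_2$, $t_j-t_i\in I$, and $(w,k)\models\varphi_1$ for all $i<k<j$. $w\models\varphi$ iff $(w,1)\models\varphi$. *)

theory Defs
  imports Complex_Main "HOL-Library.Nat_Bijection"
begin

section \<open>Parametric timed automata\<close>

datatype cmp = Lt | Le | Eq | Ge | Gt

datatype 'p bnd = Const nat | Param 'p

text \<open>A guard is the finite conjunction of the atoms in the list.\<close>

type_synonym ('x, 'p) guard = "('x \<times> cmp \<times> 'p bnd) list"

fun cmp_holds :: "cmp \<Rightarrow> real \<Rightarrow> real \<Rightarrow> bool" where
  "cmp_holds Lt s t \<longleftrightarrow> s < t"
| "cmp_holds Le s t \<longleftrightarrow> s \<le> t"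
| "cmp_holds Eq s t \<longleftrightarrow> s = t"
| "cmp_holds Ge s t \<longleftrightarrow> s \<ge> t"
| "cmp_holds Gt s t \<longleftrightarrow> s > t"

fun bnd_val :: "('p \<Rightarrow> rat) \<Rightarrow> 'p bnd \<Rightarrow> real" where
  "bnd_val v (Const n) = real n"
| "bnd_val v (Param p) = of_rat (v p)"

definition guard_sat :: "('x \<Rightarrow> real) \<Rightarrow> ('p \<Rightarrow> rat) \<Rightarrow> ('x, 'p) guard \<Rightarrow> bool" where
  "guard_sat \<nu> v g \<longleftrightarrow> (\<forall>(x, c, b) \<in> set g. cmp_holds c (\<nu> x) (bnd_val v b))"

definition guards :: "'x set \<Rightarrow> 'p set \<Rightarrow> ('x, 'p) guard set" where
  "guards X P = {g. \<forall>(x, c, b) \<in> set g. x \<in> X \<and> set_bnd b \<subseteq> P}"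

text \<open>Valuations are total functions; only their values on the clocks and parameters
  of the automaton at hand are relevant.\<close>

definition clock_valuation :: "'x set \<Rightarrow> ('x \<Rightarrow> real) \<Rightarrow> bool" where
  "clock_valuation X \<nu> \<longleftrightarrow> (\<forall>x\<in>X. 0 \<le> \<nu> x)"

definition param_valuation :: "'p set \<Rightarrow> ('p \<Rightarrow> rat) \<Rightarrow> bool" where
  "param_valuation P v \<longleftrightarrow> (\<forall>p\<in>P. 0 \<le> v p)"

record ('a, 'l, 'x, 'p) pta =
  alphabet :: "'a set"
  locs :: "'l set"
  initials :: "'l set"
  clocks :: "'x set"
  params :: "'p set"
  edges :: "('l \<times> 'a \<times> ('x, 'p) guard \<times> 'x set \<times> 'l) set"
  finals :: "'l set"

definition is_pta :: "('a, 'l, 'x, 'p) pta \<Rightarrow> bool" where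
  "is_pta A \<longleftrightarrow>
     finite (alphabet A) \<and> finite (locs A) \<and> finite (clocks A) \<and> finite (params A) \<and>
     finite (edges A) \<and> initials A \<subseteq> locs A \<and> finals A \<subseteq> locs A \<and>
     edges A \<subseteq> locs A \<times> alphabet A \<times> guards (clocks A) (params A) \<times> Pow (clocks A) \<times> locs A"

definition deterministic :: "('a, 'l, 'x, 'p) pta \<Rightarrow> bool" where
  "deterministic A \<longleftrightarrow>
     is_singleton (initials A) \<and>
     (\<forall>l a g\<^sub>1 r\<^sub>1 l\<^sub>1 g\<^sub>2 r\<^sub>2 l\<^sub>2.
        (l, a, g\<^sub>1, r\<^sub>1, l\<^sub>1) \<in> edges A \<and> (l, a, g\<^sub>2, r\<^sub>2, l\<^sub>2) \<in> edges A \<and>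
        (g\<^sub>1, r\<^sub>1, l\<^sub>1) \<noteq> (g\<^sub>2, r\<^sub>2, l\<^sub>2) \<longrightarrow>
        \<not> (\<exists>\<nu> v. clock_valuation (clocks A) \<nu> \<and> param_valuation (params A) v \<and>
                 guard_sat \<nu> v g\<^sub>1 \<and> guard_sat \<nu> v g\<^sub>2))"

definition delay :: "('x \<Rightarrow> real) \<Rightarrow> real \<Rightarrow> 'x \<Rightarrow> real" where
  "delay \<nu> \<delta> = (\<lambda>x. \<nu> x + \<delta>)"

definition reset :: "('x \<Rightarrow> real) \<Rightarrow> 'x set \<Rightarrow> 'x \<Rightarrow> real" where
  "reset \<nu> r = (\<lambda>x. if x \<in> r then 0 else \<nu> x)"

fun transition :: "('a, 'l, 'x, 'p) pta \<Rightarrow> ('p \<Rightarrow> rat) \<Rightarrow>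
    'l \<times> ('x \<Rightarrow> real) \<Rightarrow> 'a \<times> real \<Rightarrow> 'l \<times> ('x \<Rightarrow> real) \<Rightarrow> bool" where
  "transition A v (l, \<nu>) (a, \<delta>) (l', \<nu>') \<longleftrightarrow>
     0 \<le> \<delta> \<and> (\<exists>g r. (l, a, g, r, l') \<in> edges A \<and> guard_sat (delay \<nu> \<delta>) v g \<and>
                    \<nu>' = reset (delay \<nu> \<delta>) r)"

fun run :: "('a, 'l, 'x, 'p) pta \<Rightarrow> ('p \<Rightarrow> rat) \<Rightarrow>
    'l \<times> ('x \<Rightarrow> real) \<Rightarrow> ('a \<times> real) list \<Rightarrow> 'l \<times> ('x \<Rightarrow> real) \<Rightarrow> bool" where
  "run A v c [] c' \<longleftrightarrow> c = c'"
| "run A v c (s # ss) c' \<longleftrightarrow> (\<exists>d. transition A v c s d \<and> run A v d ss c')"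

definition successful :: "('a, 'l, 'x, 'p) pta \<Rightarrow> ('p \<Rightarrow> rat) \<Rightarrow> ('a \<times> real) list \<Rightarrow> bool" where
  "successful A v ss \<longleftrightarrow>
     (\<exists>l\<^sub>0 \<in> initials A. \<exists>l \<in> finals A. \<exists>\<nu>. run A v (l\<^sub>0, \<lambda>_. 0) ss (l, \<nu>))"

type_synonym 'a tword = "('a \<times> real) list"

definition timed_word :: "'a tword \<Rightarrow> bool" where
  "timed_word w \<longleftrightarrow> w \<noteq> [] \<and> sorted (map snd w) \<and> (\<forall>(a, t) \<in> set w. 0 \<le> t)"

text \<open>From letters with delays to letters with absolute times.\<close>

definition word_of :: "('a \<times> real) list \<Rightarrow> 'a tword" where
  "word_of ss = map (\<lambda>i. (fst (ss ! i), \<Sum>j\<le>i. snd (ss ! j))) [0..<length ss]"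

text \<open>Timed words are nonempty, so a run of length 0 contributes nothing.\<close>

definition lang :: "('a, 'l, 'x, 'p) pta \<Rightarrow> ('p \<Rightarrow> rat) \<Rightarrow> 'a tword set" where
  "lang A v = {w. timed_word w \<and> (\<exists>ss. successful A v ss \<and> w = word_of ss)}"


section \<open>Metric temporal logic\<close>

datatype endpoint = Incl nat | Excl nat

text \<open>The upper end \<open>None\<close> stands for infinity.\<close>

datatype ivl = Ivl endpoint "endpoint option"

fun above :: "endpoint \<Rightarrow> real \<Rightarrow> bool" where
  "above (Incl n) t \<longleftrightarrow> real n \<le> t"
| "above (Excl n) t \<longleftrightarrow> real n < t"

fun below :: "endpoint option \<Rightarrow> real \<Rightarrow> bool" where
  "below None t \<longleftrightarrow> True"
| "below (Some (Incl n)) t \<longleftrightarrow> t \<le> real n"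
| "below (Some (Excl n)) t \<longleftrightarrow> t < real n"

fun ivl_set :: "ivl \<Rightarrow> real set" where
  "ivl_set (Ivl lo hi) = {t. above lo t \<and> below hi t}"

datatype (letters: 'a) mtl =
    Letter 'a
  | Neg "'a mtl"
  | Conj "'a mtl" "'a mtl"
  | Until ivl "'a mtl" "'a mtl"

text \<open>Positions are counted from 0.\<close>

fun msat :: "'a tword \<Rightarrow> nat \<Rightarrow> 'a mtl \<Rightarrow> bool" where
  "msat w i (Letter a) \<longleftrightarrow> fst (w ! i) = a"
| "msat w i (Neg \<phi>) \<longleftrightarrow> \<not> msat w i \<phi>"
| "msat w i (Conj \<phi> \<psi>) \<longleftrightarrow> msat w i \<phi> \<and> msat w i \<psi>"
| "msat w i (Until I \<phi> \<psi>) \<longleftrightarrow>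
     (\<exists>j. i < j \<and> j < length w \<and> msat w j \<psi> \<and> snd (w ! j) - snd (w ! i) \<in> ivl_set I \<and>
          (\<forall>k. i < k \<and> k < j \<longrightarrow> msat w k \<phi>))"

definition models :: "'a tword \<Rightarrow> 'a mtl \<Rightarrow> bool" where
  "models w \<phi> \<longleftrightarrow> msat w 0 \<phi>"


section \<open>Partial recursive functions\<close>

datatype recf =
    Zero
  | Succ
  | Proj nat
  | Comp recf "recf list"
  | Prec recf recf
  | Mu recf

text \<open>\<open>rec_eval f xs y\<close>: the partial recursive function denoted by \<open>f\<close> is defined
  on \<open>xs\<close> with value \<open>y\<close>. Minimisation requires all earlier values to be defined.\<close>

inductive rec_eval :: "recf \<Rightarrow> nat list \<Rightarrow> nat \<Rightarrow> bool" where
  zero: "rec_eval Zero xs 0"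
| succ: "rec_eval Succ [x] (Suc x)"
| proj: "i < length xs \<Longrightarrow> rec_eval (Proj i) xs (xs ! i)"
| comp: "list_all2 (\<lambda>g y. rec_eval g xs y) gs ys \<Longrightarrow> rec_eval f ys z \<Longrightarrow>
    rec_eval (Comp f gs) xs z"
| prec_0: "rec_eval f xs z \<Longrightarrow> rec_eval (Prec f g) (0 # xs) z"
| prec_Suc: "rec_eval (Prec f g) (n # xs) y \<Longrightarrow> rec_eval g (n # y # xs) z \<Longrightarrow>
    rec_eval (Prec f g) (Suc n # xs) z"
| mu: "rec_eval f (n # xs) 0 \<Longrightarrow> (\<forall>m<n. \<exists>y. rec_eval f (m # xs) (Suc y)) \<Longrightarrow>
    rec_eval (Mu f) xs n"

inductive_cases rec_evalE:
  "rec_eval Zero xs y" "rec_eval Succ xs y" "rec_eval (Proj i) xs y"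
  "rec_eval (Comp f gs) xs y" "rec_eval (Prec f g) (0 # xs) y"
  "rec_eval (Prec f g) (Suc n # xs) y" "rec_eval (Mu f) xs y"

lemma rec_eval_unique: "rec_eval f xs y \<Longrightarrow> rec_eval f xs z \<Longrightarrow> y = z"
proof (induction arbitrary: z rule: rec_eval.induct)
  case (zero xs)
  then show ?case by (rule rec_evalE(1)) simp
next
  case (succ x)
  then show ?case by (rule rec_evalE(2)) simp
next
  case (proj i xs)
  then show ?case by - (erule rec_evalE(3), simp)
next
  case (comp xs gs ys f y)
  from comp.prems obtain ys' where ys': "list_all2 (\<lambda>g y. rec_eval g xs y) gs ys'"
    and f: "rec_eval f ys' z"
    by (rule rec_evalE(4))
  have "ys = ys'"
  proof (rule nth_equalityI)
    show "length ys = length ys'"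
      using list_all2_lengthD[OF comp.IH(1)] list_all2_lengthD[OF ys'] by simp
    show "ys ! i = ys' ! i" if "i < length ys" for i
    proof -
      have i: "i < length gs" using that list_all2_lengthD[OF comp.IH(1)] by simp
      show ?thesis using list_all2_nthD[OF comp.IH(1) i] list_all2_nthD[OF ys' i] by blast
    qed
  qed
  with comp.IH(2) f show ?case by blast
next
  case (prec_0 f xs y g)
  from prec_0.prems have "rec_eval f xs z" by (rule rec_evalE(5))
  then show ?case by (rule prec_0.IH)
next
  case (prec_Suc f g n xs y y')
  from prec_Suc.prems obtain u where "rec_eval (Prec f g) (n # xs) u" "rec_eval g (n # u # xs) z"
    by (rule rec_evalE(6))
  with prec_Suc.IH show ?case by blast
next
  case (mu f n xs)
  from mu.prems have z: "rec_eval f (z # xs) 0" "\<forall>m<z. \<exists>y. rec_eval f (m # xs) (Suc y)"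
    by - (erule rec_evalE(7), assumption)+
  show ?case
  proof (cases n z rule: linorder_cases)
    case less
    with z(2) obtain y where "rec_eval f (n # xs) (Suc y)" by blast
    from mu.IH(1)[OF this] show ?thesis by simp
  next
    case greater
    with mu.IH(2) obtain y where "\<forall>u. rec_eval f (z # xs) u \<longrightarrow> Suc y = u" by blast
    with z(1) have "Suc y = 0" by blast
    then show ?thesis by simp
  qed simp
qed

text \<open>A problem with instances \<open>I\<close> and question \<open>Q\<close> is decidable, relative to a numbering
  of the instances, if some partial recursive function answers correctly on the numbers of
  all instances; nothing is required (not even termination) on other inputs.\<close>

definition decidable_on :: "('i \<Rightarrow> nat) \<Rightarrow> 'i set \<Rightarrow> ('i \<Rightarrow> bool) \<Rightarrow> bool" where
  "decidable_on code I Q \<longleftrightarrow> (\<exists>f. \<forall>i\<in>I. rec_eval f [code i] (if Q i then 1 else 0))"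


section \<open>Numbering of the instances\<close>

text \<open>Letters, locations, clocks and parameters of an instance are natural numbers.
  Finite sets are numbered by \<open>set_encode\<close>, which is injective on finite sets only.\<close>

type_synonym npta = "(nat, nat, nat, nat) pta"

fun cmp_code :: "cmp \<Rightarrow> nat" where
  "cmp_code Lt = 0"
| "cmp_code Le = 1"
| "cmp_code Eq = 2"
| "cmp_code Ge = 3"
| "cmp_code Gt = 4"

fun bnd_code :: "nat bnd \<Rightarrow> nat" where
  "bnd_code (Const n) = sum_encode (Inl n)"
| "bnd_code (Param p) = sum_encode (Inr p)"

fun atom_code :: "nat \<times> cmp \<times> nat bnd \<Rightarrow> nat" where
  "atom_code (x, c, b) = list_encode [x, cmp_code c, bnd_code b]"

definition guard_code :: "(nat, nat) guard \<Rightarrow> nat" where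
  "guard_code g = list_encode (map atom_code g)"

fun edge_code :: "nat \<times> nat \<times> (nat, nat) guard \<times> nat set \<times> nat \<Rightarrow> nat" where
  "edge_code (l, a, g, r, l') = list_encode [l, a, guard_code g, set_encode r, l']"

definition pta_code :: "npta \<Rightarrow> nat" where
  "pta_code A = list_encode
     [set_encode (alphabet A), set_encode (locs A), set_encode (initials A),
      set_encode (clocks A), set_encode (params A), set_encode (edge_code ` edges A),
      set_encode (finals A)]"

fun endpoint_code :: "endpoint \<Rightarrow> nat" where
  "endpoint_code (Incl n) = sum_encode (Inl n)"
| "endpoint_code (Excl n) = sum_encode (Inr n)"

fun ivl_code :: "ivl \<Rightarrow> nat" where
  "ivl_code (Ivl lo hi) =
     list_encode [endpoint_code lo, case hi of None \<Rightarrow> 0 | Some e \<Rightarrow> Suc (endpoint_code e)]"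

fun mtl_code :: "nat mtl \<Rightarrow> nat" where
  "mtl_code (Letter a) = list_encode [0, a]"
| "mtl_code (Neg \<phi>) = list_encode [1, mtl_code \<phi>]"
| "mtl_code (Conj \<phi> \<psi>) = list_encode [2, mtl_code \<phi>, mtl_code \<psi>]"
| "mtl_code (Until I \<phi> \<psi>) = list_encode [3, ivl_code I, mtl_code \<phi>, mtl_code \<psi>]"

fun instance_code :: "npta \<times> nat mtl \<Rightarrow> nat" where
  "instance_code (A, \<phi>) = prod_encode (pta_code A, mtl_code \<phi>)"


section \<open>The model checking problem\<close>

definition mc_instances :: "(npta \<times> nat mtl) set" where
  "mc_instances = {(A, \<phi>). is_pta A \<and> letters \<phi> \<subseteq> alphabet A}"

definition det_1clock_1param_instances :: "(npta \<times> nat mtl) set" where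
  "det_1clock_1param_instances =
     {(A, \<phi>) \<in> mc_instances. deterministic A \<and> card (clocks A) = 1 \<and> card (params A) = 1}"

definition mc_holds :: "npta \<times> nat mtl \<Rightarrow> bool" where
  "mc_holds = (\<lambda>(A, \<phi>). \<exists>v. param_valuation (params A) v \<and> (\<forall>w \<in> lang A v. models w \<phi>))"


section \<open>The numbering is injective\<close>

lemma cmp_code_inj: "cmp_code c = cmp_code d \<Longrightarrow> c = d"
  by (cases c; cases d) auto

lemma bnd_code_inj: "bnd_code b = bnd_code c \<Longrightarrow> b = c"
  by (cases b; cases c) (simp_all add: sum_encode_eq)

lemma atom_code_inj: "inj atom_code"
proof (rule injI)
  fix s t assume "atom_code s = atom_code t"
  then show "s = t"
    by (cases s; cases t) (simp only: atom_code.simps list_encode_eq, auto dest: cmp_code_inj bnd_code_inj)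
qed

lemma guard_code_inj: "guard_code g = guard_code h \<Longrightarrow> g = h"
  by (simp add: guard_code_def atom_code_inj list_encode_eq)

lemma edge_code_inj_on: "inj_on edge_code {(l, a, g, r, l'). finite r}"
proof (rule inj_onI)
  fix d e
  assume fin: "d \<in> {(l, a, g, r, l'). finite r}" "e \<in> {(l, a, g, r, l'). finite r}"
    and eq: "edge_code d = edge_code e"
  obtain l a g r l' where d: "d = (l, a, g, r, l')" by (metis prod_cases5)
  obtain k b h s k' where e: "e = (k, b, h, s, k')" by (metis prod_cases5)
  have "[l, a, guard_code g, set_encode r, l'] = [k, b, guard_code h, set_encode s, k']"
    using eq unfolding d e edge_code.simps list_encode_eq .
  then show "d = e"
    using fin unfolding d e by (auto simp: set_encode_eq dest: guard_code_inj)
qed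

lemma endpoint_code_inj: "endpoint_code e = endpoint_code f \<Longrightarrow> e = f"
  by (cases e; cases f) (simp_all add: sum_encode_eq)

lemma ivl_code_inj: "ivl_code I = ivl_code J \<Longrightarrow> I = J"
  by (cases I; cases J; simp only: ivl_code.simps list_encode_eq)
     (auto split: option.splits dest: endpoint_code_inj)

lemma mtl_code_inj: "mtl_code \<phi> = mtl_code \<psi> \<Longrightarrow> \<phi> = \<psi>"
proof (induction \<phi> arbitrary: \<psi>)
  case (Letter a)
  then show ?case by (cases \<psi>; simp only: mtl_code.simps list_encode_eq) auto
next
  case (Neg \<phi>)
  from Neg.prems obtain \<psi>' where "\<psi> = Neg \<psi>'" "mtl_code \<phi> = mtl_code \<psi>'"
    by (cases \<psi>; simp only: mtl_code.simps list_encode_eq) auto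
  with Neg.IH show ?case by blast
next
  case (Conj \<phi>1 \<phi>2)
  from Conj.prems obtain \<psi>1 \<psi>2 where "\<psi> = Conj \<psi>1 \<psi>2"
    "mtl_code \<phi>1 = mtl_code \<psi>1" "mtl_code \<phi>2 = mtl_code \<psi>2"
    by (cases \<psi>; simp only: mtl_code.simps list_encode_eq) auto
  with Conj.IH show ?case by blast
next
  case (Until I \<phi>1 \<phi>2)
  from Until.prems obtain J \<psi>1 \<psi>2 where "\<psi> = Until J \<psi>1 \<psi>2" "ivl_code I = ivl_code J"
    "mtl_code \<phi>1 = mtl_code \<psi>1" "mtl_code \<phi>2 = mtl_code \<psi>2"
    by (cases \<psi>; simp only: mtl_code.simps list_encode_eq) auto
  with Until.IH show ?case by (blast dest: ivl_code_inj)
qed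

lemma is_pta_finite:
  assumes "is_pta A"
  shows "finite (alphabet A)" "finite (locs A)" "finite (initials A)" "finite (clocks A)"
    "finite (params A)" "finite (edges A)" "finite (finals A)"
    "edges A \<subseteq> {(l, a, g, r, l'). finite r}"
proof -
  show "edges A \<subseteq> {(l, a, g, r, l'). finite r}"
  proof clarify
    fix l a g r l' assume "(l, a, g, r, l') \<in> edges A"
    then have "r \<subseteq> clocks A" using assms unfolding is_pta_def by blast
    then show "finite r" using assms unfolding is_pta_def by (metis finite_subset)
  qed
qed (use assms in \<open>auto simp: is_pta_def dest: finite_subset\<close>)

lemma pta_code_inj:
  assumes A: "is_pta A" and B: "is_pta B" and eq: "pta_code A = pta_code B"
  shows "A = B"
proof -
  note fA = is_pta_finite[OF A] and fB = is_pta_finite[OF B]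
  note eqs = eq[unfolded pta_code_def list_encode_eq list.inject]
  have "edge_code ` edges A = edge_code ` edges B"
    using eqs fA(6) fB(6) by (simp add: set_encode_eq)
  then have "edges A = edges B"
    using inj_on_image_eq_iff[OF edge_code_inj_on fA(8) fB(8)] by blast
  moreover have "alphabet A = alphabet B" "locs A = locs B" "initials A = initials B"
    "clocks A = clocks B" "params A = params B" "finals A = finals B"
    using eqs fA(1-5,7) fB(1-5,7) by (simp_all add: set_encode_eq)
  ultimately show ?thesis by simp
qed

lemma instance_code_inj_on: "inj_on instance_code mc_instances"
  by (auto simp: inj_on_def mc_instances_def dest: pta_code_inj mtl_code_inj)

end

theory Submission
  imports Defs
begin

text \<open>The automaton has one location and, for every letter, one loop with guard \<open>x = p\<close> that
  resets \<open>x\<close>; its timed words are the words with an event at every multiple of \<open>p\<close>. If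
  \<open>p = 1 / m\<close>, the operator \<open>Until\<close> with the interval \<open>[1, 1]\<close> relates every event to the
  \<open>m\<close>-th event after it, so that MTL describes the computations of a machine on a cyclic tape
  of length \<open>m\<close>, without insertion errors. A counter program with unary registers runs on such
  a tape; some tape is long enough for the whole computation iff the registers stay bounded.

  Undecidability follows by diagonalisation, without a universal machine. Given a decision
  procedure \<open>f\<close>, let the program compute \<open>f\<close> on the instance that consists of an automaton with
  code \<open>a\<close> and of the specification that a formula with code \<open>b\<close>, started on the input \<open>(a, b)\<close>,
  does not describe an overflow; if the answer is 1 the program overflows on every tape,
  otherwise it halts. The formula \<open>\<theta>\<close> for this program and its automaton have codes of their
  own, and on these two codes \<open>f\<close> errs. The code of the instance depends on \<open>a\<close> and \<open>b\<close> only,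
  through pairing and iteration.\<close>

section \<open>Counter programs for partial recursive functions\<close>

datatype instr = Inc nat | Loop nat "instr list"

fun step :: "instr list \<times> (nat \<Rightarrow> nat) \<Rightarrow> instr list \<times> (nat \<Rightarrow> nat)" where
  "step ([], s) = ([], s)"
| "step (Inc r # k, s) = (k, s(r := Suc (s r)))"
| "step (Loop r c # k, s) =
     (if s r = 0 then (k, s) else (c @ Loop r c # k, s(r := s r - 1)))"

text \<open>Quantifying over the continuation \<open>k\<close> makes the relation compositional: the
  same program can be run in front of any remaining code, in particular inside a loop body.\<close>

definition runs :: "instr list \<Rightarrow> (nat \<Rightarrow> nat) \<Rightarrow> (nat \<Rightarrow> nat) \<Rightarrow> bool" where
  "runs P s s' \<longleftrightarrow> (\<forall>k. \<exists>n. (step ^^ n) (P @ k, s) = (k, s'))"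

lemma funpow_trans: "(f ^^ m) x = y \<Longrightarrow> (f ^^ n) y = z \<Longrightarrow> (f ^^ (n + m)) x = z"
  by (simp add: funpow_add)

lemma runs_Nil: "runs [] s s"
  unfolding runs_def by (auto intro: exI[of _ 0])

lemma runs_append:
  assumes "runs P s s'" "runs Q s' s''"
  shows "runs (P @ Q) s s''"
  unfolding runs_def
proof
  fix k
  obtain m where "(step ^^ m) (P @ (Q @ k), s) = (Q @ k, s')"
    using assms(1) unfolding runs_def by blast
  moreover obtain n where "(step ^^ n) (Q @ k, s') = (k, s'')"
    using assms(2) unfolding runs_def by blast
  ultimately show "\<exists>n. (step ^^ n) ((P @ Q) @ k, s) = (k, s'')"
    by (metis append_assoc funpow_trans)
qed

lemma runs_Cons: "runs [i] s s' \<Longrightarrow> runs P s' s'' \<Longrightarrow> runs (i # P) s s''"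
  using runs_append[of "[i]"] by simp

lemma runs_Inc: "runs [Inc r] s (s(r := Suc (s r)))"
  unfolding runs_def by (auto intro!: exI[of _ 1])

lemma runs_Loop_0: "s r = 0 \<Longrightarrow> runs [Loop r c] s s"
  unfolding runs_def by (auto intro!: exI[of _ 1])

lemma runs_Loop_Suc:
  assumes "s r \<noteq> 0" "runs c (s(r := s r - 1)) s'" "runs [Loop r c] s' s''"
  shows "runs [Loop r c] s s''"
  unfolding runs_def
proof
  fix k
  have 1: "(step ^^ 1) ([Loop r c] @ k, s) = (c @ [Loop r c] @ k, s(r := s r - 1))"
    using assms(1) by simp
  obtain m where 2: "(step ^^ m) (c @ [Loop r c] @ k, s(r := s r - 1)) = ([Loop r c] @ k, s')"
    using assms(2) unfolding runs_def by blast
  obtain n where 3: "(step ^^ n) ([Loop r c] @ k, s') = (k, s'')"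
    using assms(3) unfolding runs_def by blast
  show "\<exists>n. (step ^^ n) ([Loop r c] @ k, s) = (k, s'')"
    using funpow_trans[OF funpow_trans[OF 1 2] 3] by blast
qed

section \<open>Clearing, moving and copying registers\<close>

lemma runs_clear: "runs [Loop r []] s (s(r := 0))"
proof (induction "s r" arbitrary: s)
  case 0
  then show ?case using runs_Loop_0[of s r] by (simp add: fun_upd_idem)
next
  case (Suc n)
  have "runs [Loop r []] (s(r := s r - 1)) (s(r := 0))"
    using Suc(1)[of "s(r := s r - 1)"] Suc(2) by simp
  from runs_Loop_Suc[OF _ runs_Nil this] Suc(2) show ?case by simp
qed

lemma runs_clears: "runs (map (\<lambda>r. Loop r []) rs) s (\<lambda>r. if r \<in> set rs then 0 else s r)"
proof (induction rs arbitrary: s)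
  case Nil
  then show ?case by (simp add: runs_Nil)
next
  case (Cons a rs)
  have "(\<lambda>r. if r \<in> set rs then 0 else (s(a := 0)) r) = (\<lambda>r. if r \<in> set (a # rs) then 0 else s r)"
    by auto
  with runs_Cons[OF runs_clear[of a s] Cons[of "s(a := 0)"]] show ?case by simp
qed

lemma runs_move:
  assumes "r \<noteq> d"
  shows "runs [Loop r [Inc d]] s (s(r := 0, d := s d + s r))"
proof (induction "s r" arbitrary: s)
  case 0
  then have eq: "s(r := 0, d := s d + s r) = s" by auto
  show ?case unfolding eq by (rule runs_Loop_0) (simp add: 0)
next
  case (Suc n)
  let ?s = "s(r := s r - 1, d := Suc (s d))"
  have "runs [Loop r [Inc d]] ?s (?s(r := 0, d := ?s d + ?s r))"
    using Suc assms by (intro Suc(1)) auto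
  moreover have "?s(r := 0, d := ?s d + ?s r) = s(r := 0, d := s d + s r)"
    using Suc(2) assms by auto
  moreover have "runs [Inc d] (s(r := s r - 1)) ?s"
    using runs_Inc[of d "s(r := s r - 1)"] assms by simp
  ultimately show ?case using runs_Loop_Suc[of s r "[Inc d]" ?s] Suc(2) by simp
qed

lemma runs_dup:
  assumes "r \<noteq> d" "r \<noteq> e" "d \<noteq> e"
  shows "runs [Loop r [Inc d, Inc e]] s (s(r := 0, d := s d + s r, e := s e + s r))"
proof (induction "s r" arbitrary: s)
  case 0
  then have eq: "s(r := 0, d := s d + s r, e := s e + s r) = s" by auto
  show ?case unfolding eq by (rule runs_Loop_0) (simp add: 0)
next
  case (Suc n)
  let ?s = "s(r := s r - 1, d := Suc (s d), e := Suc (s e))"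
  have "runs [Loop r [Inc d, Inc e]] ?s (?s(r := 0, d := ?s d + ?s r, e := ?s e + ?s r))"
    using Suc assms by (intro Suc(1)) auto
  moreover have "?s(r := 0, d := ?s d + ?s r, e := ?s e + ?s r)
      = s(r := 0, d := s d + s r, e := s e + s r)"
    using Suc(2) assms by auto
  moreover have "runs [Inc d, Inc e] (s(r := s r - 1)) ?s"
    using runs_Cons[OF runs_Inc[of d "s(r := s r - 1)"] runs_Inc[of e]] assms by simp
  ultimately show ?case using runs_Loop_Suc[of s r "[Inc d, Inc e]" ?s] Suc(2) by simp
qed

text \<open>A loop destroys its counter, so \<open>r\<close> is first emptied into two scratch
  registers; one copy restores \<open>r\<close>, the other goes to \<open>d\<close>. Since
  \<open>d\<close> is cleared after \<open>r\<close> has been restored and is then filled from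
  scratch, \<open>d = r\<close> is harmless.\<close>

definition assign :: "nat \<Rightarrow> nat \<Rightarrow> nat \<Rightarrow> instr list" where
  "assign d r e = [Loop r [Inc e, Inc (Suc e)], Loop (Suc e) [Inc r], Loop d [], Loop e [Inc d]]"

lemma runs_assign:
  assumes "r < e" "d < e" "s e = 0" "s (Suc e) = 0"
  shows "runs (assign d r e) s (s(d := s r))"
proof -
  let ?s1 = "s(r := 0, e := s e + s r, Suc e := s (Suc e) + s r)"
  let ?s2 = "s(e := s r)"
  let ?s3 = "s(e := s r, d := 0)"
  have "runs [Loop r [Inc e, Inc (Suc e)]] s ?s1"
    using assms by (intro runs_dup) auto
  moreover have "runs [Loop (Suc e) [Inc r]] ?s1 ?s2"
  proof -
    have "?s1(Suc e := 0, r := ?s1 r + ?s1 (Suc e)) = ?s2"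
      using assms by auto
    then show ?thesis using runs_move[of "Suc e" r ?s1] assms by simp
  qed
  moreover have "runs [Loop d []] ?s2 ?s3"
    by (rule runs_clear)
  moreover have "runs [Loop e [Inc d]] ?s3 (s(d := s r))"
  proof -
    have "?s3(e := 0, d := ?s3 d + ?s3 e) = s(d := s r)"
      using assms by auto
    then show ?thesis using runs_move[of e d ?s3] assms by simp
  qed
  ultimately show ?thesis unfolding assign_def by (blast intro: runs_Cons)
qed

text \<open>The registers from \<open>e\<close> on are scratch space, which every program leaves clean.\<close>

definition programmable :: "recf \<Rightarrow> bool" where
  "programmable f \<longleftrightarrow> (\<forall>srcs d e. (\<forall>r\<in>set srcs. r < e) \<longrightarrow> d < e \<longrightarrow>
     (\<exists>P. \<forall>s y. (\<forall>r\<ge>e. s r = 0) \<longrightarrow> rec_eval f (map s srcs) y \<longrightarrow> runs P s (s(d := y))))"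

lemma programmableE:
  assumes "programmable f" "\<forall>r\<in>set srcs. r < e" "d < e"
  obtains P where "\<And>s y. \<forall>r\<ge>e. s r = 0 \<Longrightarrow> rec_eval f (map s srcs) y \<Longrightarrow> runs P s (s(d := y))"
  using assms unfolding programmable_def by blast

lemma programmableI:
  assumes "\<And>srcs d e. \<forall>r\<in>set srcs. r < e \<Longrightarrow> d < e \<Longrightarrow>
    \<exists>P. \<forall>s y. (\<forall>r\<ge>e. s r = 0) \<longrightarrow> rec_eval f (map s srcs) y \<longrightarrow> runs P s (s(d := y))"
  shows "programmable f"
  using assms unfolding programmable_def by blast

section \<open>One program for each constructor of partial recursive functions\<close>

lemma programmable_Zero: "programmable Zero"
proof (rule programmableI)
  fix srcs and d e :: nat
  show "\<exists>P. \<forall>s y. (\<forall>r\<ge>e. s r = 0) \<longrightarrow> rec_eval Zero (map s srcs) y \<longrightarrow> runs P s (s(d := y))"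
    by (intro exI[of _ "[Loop d []]"]) (auto elim: rec_evalE intro: runs_clear)
qed

lemma programmable_Succ: "programmable Succ"
proof (rule programmableI)
  fix srcs and d e :: nat
  assume "\<forall>r\<in>set srcs. r < e" "d < e"
  then have "runs (assign d (hd srcs) e @ [Inc d]) s (s(d := y))"
    if s: "\<forall>r\<ge>e. s r = 0" and y: "rec_eval Succ (map s srcs) y" for s y
  proof -
    obtain r where r: "srcs = [r]" "y = Suc (s r)"
      using y by (auto elim: rec_evalE)
    have "runs (assign d r e) s (s(d := s r))"
      using s r \<open>\<forall>r\<in>set srcs. r < e\<close> \<open>d < e\<close> by (intro runs_assign) auto
    from runs_append[OF this runs_Inc[of d]] r show ?thesis by simp
  qed
  then show "\<exists>P. \<forall>s y. (\<forall>r\<ge>e. s r = 0) \<longrightarrow> rec_eval Succ (map s srcs) y \<longrightarrow> runs P s (s(d := y))"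
    by blast
qed

lemma programmable_Proj: "programmable (Proj i)"
proof (rule programmableI)
  fix srcs and d e :: nat
  assume "\<forall>r\<in>set srcs. r < e" "d < e"
  then have "runs (assign d (srcs ! i) e) s (s(d := y))"
    if s: "\<forall>r\<ge>e. s r = 0" and y: "rec_eval (Proj i) (map s srcs) y" for s y
  proof -
    have i: "i < length srcs" "y = s (srcs ! i)"
      using y by (auto elim: rec_evalE)
    then show ?thesis
      using s i \<open>\<forall>r\<in>set srcs. r < e\<close> \<open>d < e\<close> by (auto intro: runs_assign)
  qed
  then show "\<exists>P. \<forall>s y. (\<forall>r\<ge>e. s r = 0) \<longrightarrow> rec_eval (Proj i) (map s srcs) y \<longrightarrow>
      runs P s (s(d := y))"
    by blast
qed

text \<open>The arguments of a composition are computed into consecutive registers from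
  \<open>j\<close> on. The sources lie below \<open>j\<close>, so a result never disturbs a later
  call; \<open>e\<close> stays fixed while \<open>j\<close> grows, which keeps the whole block out
  of the scratch space.\<close>

lemma programmable_block:
  assumes "\<forall>g\<in>set gs. programmable g" "\<forall>r\<in>set srcs. r < j" "j + length gs \<le> e"
  shows "\<exists>P. \<forall>s ys. (\<forall>r\<ge>e. s r = 0) \<longrightarrow> list_all2 (\<lambda>g y. rec_eval g (map s srcs) y) gs ys \<longrightarrow>
    runs P s (\<lambda>r. if j \<le> r \<and> r < j + length gs then ys ! (r - j) else s r)"
  using assms
proof (induction gs arbitrary: j)
  case Nil
  have "(\<lambda>r. if j \<le> r \<and> r < j then ys ! (r - j) else s r) = s"
    for ys and s :: "nat \<Rightarrow> nat"
    by (rule ext) auto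
  then show ?case using runs_Nil by (intro exI[of _ "[]"]) simp
next
  case (Cons g gs)
  have "programmable g" and less: "\<forall>r\<in>set srcs. r < e" "j < e" using Cons.prems by auto
  then obtain P where P: "\<And>s y. \<forall>r\<ge>e. s r = 0 \<Longrightarrow> rec_eval g (map s srcs) y \<Longrightarrow> runs P s (s(j := y))"
    by (rule programmableE) blast
  have "\<forall>g\<in>set gs. programmable g" "\<forall>r\<in>set srcs. r < Suc j" "Suc j + length gs \<le> e"
    using Cons.prems by auto
  from Cons.IH[OF this] obtain Q where Q: "\<And>s ys. \<forall>r\<ge>e. s r = 0 \<Longrightarrow> list_all2 (\<lambda>g y. rec_eval g (map s srcs) y) gs ys \<Longrightarrow>
    runs Q s (\<lambda>r. if Suc j \<le> r \<and> r < Suc j + length gs then ys ! (r - Suc j) else s r)"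
    by blast
  have "runs (P @ Q) s (\<lambda>r. if j \<le> r \<and> r < j + length (g # gs) then ys ! (r - j) else s r)"
    if s: "\<forall>r\<ge>e. s r = 0" and ys: "list_all2 (\<lambda>g y. rec_eval g (map s srcs) y) (g # gs) ys" for s ys
  proof -
    obtain z zs where z: "ys = z # zs" "rec_eval g (map s srcs) z"
      "list_all2 (\<lambda>g y. rec_eval g (map s srcs) y) gs zs"
      using ys by (auto simp: list_all2_Cons1)
    let ?s = "s(j := z)"
    have args: "map ?s srcs = map s srcs" using Cons.prems(2) by auto
    have 1: "runs Q ?s (\<lambda>r. if Suc j \<le> r \<and> r < Suc j + length gs then zs ! (r - Suc j) else ?s r)"
      using s Cons.prems(3) by (intro Q, simp) (unfold args, rule z(3))
    have "(\<lambda>r. if Suc j \<le> r \<and> r < Suc j + length gs then zs ! (r - Suc j) else ?s r)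
      = (\<lambda>r. if j \<le> r \<and> r < j + length (g # gs) then ys ! (r - j) else s r)"
      by (rule ext) (auto simp: z nth_Cons')
    with runs_append[OF P[OF s z(2)] 1] show ?thesis by simp
  qed
  then show ?case by blast
qed

lemma programmable_Comp:
  assumes "programmable f" "\<forall>g\<in>set gs. programmable g"
  shows "programmable (Comp f gs)"
proof (rule programmableI)
  fix srcs and d e :: nat
  assume srcs: "\<forall>r\<in>set srcs. r < e" and d: "d < e"
  \<comment> \<open>The results occupy the first \<open>?n\<close> registers of the old scratch
    space; the scratch space of the parts starts behind them, and the block is cleared at the
    end.\<close>
  let ?n = "length gs"
  obtain P where P: "\<And>s ys. \<forall>r\<ge>e + ?n. s r = 0 \<Longrightarrow>
      list_all2 (\<lambda>g y. rec_eval g (map s srcs) y) gs ys \<Longrightarrow>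
      runs P s (\<lambda>r. if e \<le> r \<and> r < e + ?n then ys ! (r - e) else s r)"
    using programmable_block[OF assms(2) srcs, of "e + ?n"] by blast
  have "\<forall>r\<in>set [e..<e + ?n]. r < e + ?n" "d < e + ?n" using d by auto
  then obtain Q where Q: "\<And>s y. \<forall>r\<ge>e + ?n. s r = 0 \<Longrightarrow> rec_eval f (map s [e..<e + ?n]) y \<Longrightarrow>
      runs Q s (s(d := y))"
    by (rule programmableE[OF assms(1)]) blast
  have "runs (P @ Q @ map (\<lambda>r. Loop r []) [e..<e + ?n]) s (s(d := y))"
    if s: "\<forall>r\<ge>e. s r = 0" and y: "rec_eval (Comp f gs) (map s srcs) y" for s y
  proof -
    obtain ys where ys: "list_all2 (\<lambda>g y. rec_eval g (map s srcs) y) gs ys" "rec_eval f ys y"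
      using y by (auto elim: rec_evalE)
    have n: "length ys = ?n" using ys(1) by (simp add: list_all2_lengthD)
    let ?s = "\<lambda>r. if e \<le> r \<and> r < e + ?n then ys ! (r - e) else s r"
    have 1: "runs P s ?s" using s ys by (intro P) auto
    have "map ?s [e..<e + ?n] = ys" by (rule nth_equalityI) (auto simp: n)
    then have 2: "runs Q ?s (?s(d := y))" using s ys(2) by (intro Q) auto
    have "(\<lambda>r. if r \<in> set [e..<e + ?n] then 0 else (?s(d := y)) r) = s(d := y)"
      using s d by (auto simp: fun_eq_iff)
    then show ?thesis using runs_append[OF 1 runs_append[OF 2 runs_clears[of "[e..<e + ?n]"]]] by simp
  qed
  then show "\<exists>P. \<forall>s y. (\<forall>r\<ge>e. s r = 0) \<longrightarrow> rec_eval (Comp f gs) (map s srcs) y \<longrightarrow>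
      runs P s (s(d := y))"
    by blast
qed

text \<open>A program computes a recursion bottom up; the sequence \<open>Y\<close> of intermediate
  values will be the invariant of its loop.\<close>

lemma rec_eval_Prec_seq:
  assumes "rec_eval (Prec f g) (n # xs) y"
  obtains Y where "rec_eval f xs (Y 0)" "\<And>i. i < n \<Longrightarrow> rec_eval g (i # Y i # xs) (Y (Suc i))" "Y n = y"
proof -
  have "\<exists>Y. rec_eval f xs (Y 0) \<and> (\<forall>i<n. rec_eval g (i # Y i # xs) (Y (Suc i))) \<and> Y n = y"
    using assms
  proof (induction n arbitrary: y)
    case 0
    then show ?case by (auto elim: rec_evalE intro!: exI[of _ "\<lambda>_. y"])
  next
    case (Suc n)
    then obtain z where z: "rec_eval (Prec f g) (n # xs) z" "rec_eval g (n # z # xs) y"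
      by (auto elim: rec_evalE)
    from Suc.IH[OF z(1)] obtain Y where
      "rec_eval f xs (Y 0)" "\<forall>i<n. rec_eval g (i # Y i # xs) (Y (Suc i))" "Y n = z" by blast
    then show ?case using z(2)
      by (intro exI[of _ "Y(Suc n := y)"]) (auto simp: less_Suc_eq)
  qed
  then show thesis using that by blast
qed

lemma programmable_Prec:
  assumes "programmable f" "programmable g"
  shows "programmable (Prec f g)"
proof (rule programmableI)
  fix srcs and d e :: nat
  assume srcs: "\<forall>r\<in>set srcs. r < e" and d: "d < e"
  let ?x = "hd srcs" and ?rs = "tl srcs"
  have rs: "\<forall>r\<in>set ?rs. r < e" using srcs by (cases srcs) auto
  have "\<forall>r\<in>set ?rs. r < e + 3" "e < e + 3" using rs by auto
  then obtain F where F: "\<And>s y. \<forall>r\<ge>e + 3. s r = 0 \<Longrightarrow> rec_eval f (map s ?rs) y \<Longrightarrow>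
      runs F s (s(e := y))"
    by (rule programmableE[OF assms(1)]) blast
  have "\<forall>r\<in>set (Suc e # e # ?rs). r < e + 3" "e < e + 3" using rs by auto
  then obtain G where G: "\<And>s y. \<forall>r\<ge>e + 3. s r = 0 \<Longrightarrow>
      rec_eval g (map s (Suc e # e # ?rs)) y \<Longrightarrow> runs G s (s(e := y))"
    by (rule programmableE[OF assms(2)]) blast
  \<comment> \<open>Register \<open>e\<close> holds the intermediate value, \<open>Suc e\<close> the
    index of the round, \<open>e + 2\<close> the number of rounds still to do.\<close>
  let ?L = "Loop (e + 2) (G @ [Inc (Suc e)])"
  let ?P = "F @ assign (e + 2) ?x (e + 3) @ [?L] @ assign d e (e + 3) @ map (\<lambda>r. Loop r []) [e, Suc e]"
  have "runs ?P s (s(d := y))"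
    if s: "\<forall>r\<ge>e. s r = 0" and y: "rec_eval (Prec f g) (map s srcs) y" for s y
  proof -
    have "srcs \<noteq> []" using y by (auto elim: rec_eval.cases)
    then have "srcs = ?x # ?rs" by simp
    then have x: "?x < e" and y': "rec_eval (Prec f g) (s ?x # map s ?rs) y"
      using y srcs by (metis list.set_intros(1), metis list.simps(9))
    define n where "n = s ?x"
    from y' obtain Y where Y: "rec_eval f (map s ?rs) (Y 0)"
      "\<And>i. i < n \<Longrightarrow> rec_eval g (i # Y i # map s ?rs) (Y (Suc i))" "Y n = y"
      unfolding n_def by (rule rec_eval_Prec_seq) blast
    define S where "S i = s(e := Y i, Suc e := i, e + 2 := n - i)" for i
    have S: "\<forall>r\<ge>e + 3. S i r = 0" "map (S i) ?rs = map s ?rs" for i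
      using s rs by (auto simp: S_def)
    have 1: "runs F s (s(e := Y 0))" using s Y by (intro F) auto
    have 2: "runs (assign (e + 2) ?x (e + 3)) (s(e := Y 0)) (S 0)"
    proof -
      have "(s(e := Y 0))(e + 2 := (s(e := Y 0)) ?x) = S 0"
        using x s by (auto simp: S_def n_def)
      then show ?thesis using runs_assign[of ?x "e + 3" "e + 2" "s(e := Y 0)"] x s by auto
    qed
    have "runs [?L] (S i) (S n)" if "i \<le> n" for i
      using that
    proof (induction rule: inc_induct)
      case base
      show ?case by (rule runs_Loop_0) (simp add: S_def)
    next
      case (step i)
      let ?S = "(S i)(e + 2 := S i (e + 2) - 1)"
      have "map ?S ?rs = map s ?rs" using rs by (auto simp: S_def)
      moreover have "?S (Suc e) = i" "?S e = Y i" by (simp_all add: S_def)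
      ultimately have args: "map ?S (Suc e # e # ?rs) = i # Y i # map s ?rs" by (simp only: list.map)
      have "rec_eval g (map ?S (Suc e # e # ?rs)) (Y (Suc i))"
        unfolding args by (rule Y(2)[OF step(2)])
      then have "runs G ?S (?S(e := Y (Suc i)))"
        using S(1) by (intro G) auto
      moreover have "(?S(e := Y (Suc i)))(Suc e := Suc ((?S(e := Y (Suc i))) (Suc e))) = S (Suc i)"
        by (auto simp: S_def)
      ultimately have "runs (G @ [Inc (Suc e)]) ?S (S (Suc i))"
        using runs_append[OF _ runs_Inc[of "Suc e" "?S(e := Y (Suc i))"]] by simp
      moreover have "S i (e + 2) \<noteq> 0" using step(2) by (simp add: S_def)
      ultimately show ?case using runs_Loop_Suc step.IH by blast
    qed
    then have 3: "runs [?L] (S 0) (S n)" by simp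
    have 4: "runs (assign d e (e + 3)) (S n) ((S n)(d := y))"
      using runs_assign[of e "e + 3" d "S n"] d S(1) Y(3) by (simp add: S_def)
    have 5: "(\<lambda>r. if r \<in> set [e, Suc e] then 0 else ((S n)(d := y)) r) = s(d := y)"
      using s d by (auto simp: S_def fun_eq_iff)
    show ?thesis
      using runs_append[OF 1 runs_append[OF 2 runs_append[OF 3 runs_append[OF 4
            runs_clears[of "[e, Suc e]"]]]]]
      unfolding 5 by simp
  qed
  then show "\<exists>P. \<forall>s y. (\<forall>r\<ge>e. s r = 0) \<longrightarrow> rec_eval (Prec f g) (map s srcs) y \<longrightarrow>
      runs P s (s(d := y))"
    by blast
qed

lemma programmable_Mu:
  assumes "programmable f"
  shows "programmable (Mu f)"
proof (rule programmableI)
  fix srcs and d e :: nat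
  assume srcs: "\<forall>r\<in>set srcs. r < e" and d: "d < e"
  have "\<forall>r\<in>set (e # srcs). r < e + 3" "e + 2 < e + 3" using srcs by auto
  then obtain F where F: "\<And>s y. \<forall>r\<ge>e + 3. s r = 0 \<Longrightarrow> rec_eval f (map s (e # srcs)) y \<Longrightarrow>
      runs F s (s(e + 2 := y))"
    by (rule programmableE[OF assms]) blast
  \<comment> \<open>Register \<open>e\<close> holds the candidate, \<open>Suc e\<close> a flag to go
    on, \<open>e + 2\<close> the value of \<open>f\<close>. \<open>?T\<close> is a conditional: its
    body clears the register tested and so runs at most once. Only a nonzero value sets the flag
    again and advances the candidate.\<close>
  let ?T = "Loop (e + 2) [Loop (e + 2) [], Inc (Suc e), Inc e]"
  let ?L = "Loop (Suc e) (F @ [?T])"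
  let ?P = "[Inc (Suc e)] @ [?L] @ assign d e (e + 3) @ [Loop e []]"
  have "runs ?P s (s(d := n))"
    if s: "\<forall>r\<ge>e. s r = 0" and n: "rec_eval (Mu f) (map s srcs) n" for s n
  proof -
    from n have z: "rec_eval f (n # map s srcs) 0"
      and nz: "\<And>i. i < n \<Longrightarrow> \<exists>y. rec_eval f (i # map s srcs) (Suc y)"
      by (auto elim: rec_evalE)
    define S where "S i = s(e := i, Suc e := 1)" for i
    have S: "\<forall>r\<ge>e + 3. ((S i)(Suc e := 0)) r = 0" "map ((S i)(Suc e := 0)) (e # srcs) = i # map s srcs"
      for i using s srcs by (auto simp: S_def)
    have 1: "runs [Inc (Suc e)] s (S 0)"
    proof -
      have "s(Suc e := Suc (s (Suc e))) = S 0" using s by (auto simp: S_def)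
      then show ?thesis using runs_Inc[of "Suc e" s] by simp
    qed
    have "runs [?L] (S i) (s(e := n))" if "i \<le> n" for i
      using that
    proof (induction rule: inc_induct)
      case base
      have "rec_eval f (map ((S n)(Suc e := 0)) (e # srcs)) 0"
        unfolding S(2) by (rule z)
      from F[OF S(1) this] have "runs F ((S n)(Suc e := 0)) ((S n)(Suc e := 0, e + 2 := 0))" .
      moreover have "(S n)(Suc e := 0, e + 2 := 0) = s(e := n)"
        using s by (auto simp: S_def)
      ultimately have "runs F ((S n)(Suc e := 0)) (s(e := n))" by simp
      moreover have "runs [?T] (s(e := n)) (s(e := n))"
        using s by (intro runs_Loop_0) auto
      ultimately have "runs (F @ [?T]) ((S n)(Suc e := 0)) (s(e := n))"
        by (rule runs_append)
      moreover have "(S n)(Suc e := 0) = (S n)(Suc e := S n (Suc e) - 1)" by (simp add: S_def)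
      moreover have "runs [?L] (s(e := n)) (s(e := n))"
        using s by (intro runs_Loop_0) auto
      moreover have "S n (Suc e) \<noteq> 0" by (simp add: S_def)
      ultimately show ?case using runs_Loop_Suc by metis
    next
      case (step i)
      from nz[OF step(2)] obtain y where y: "rec_eval f (i # map s srcs) (Suc y)" by blast
      let ?S = "(S i)(Suc e := 0, e + 2 := Suc y)"
      have "rec_eval f (map ((S i)(Suc e := 0)) (e # srcs)) (Suc y)"
        unfolding S(2) by (rule y)
      from F[OF S(1) this] have "runs F ((S i)(Suc e := 0)) ?S" .
      moreover have "runs [?T] ?S (S (Suc i))"
      proof (rule runs_Loop_Suc)
        let ?s1 = "?S(e + 2 := ?S (e + 2) - 1)"
        let ?s2 = "?s1(e + 2 := 0)"
        let ?s3 = "?s2(Suc e := Suc (?s2 (Suc e)))"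
        have "?s3(e := Suc (?s3 e)) = S (Suc i)" using s by (auto simp: S_def)
        then show "runs [Loop (e + 2) [], Inc (Suc e), Inc e] ?s1 (S (Suc i))"
          using runs_Cons[OF runs_clear[of "e + 2" ?s1] runs_Cons[OF runs_Inc[of "Suc e" ?s2]
                runs_Inc[of e ?s3]]] by simp
        show "runs [?T] (S (Suc i)) (S (Suc i))"
          using s by (intro runs_Loop_0) (auto simp: S_def)
      qed simp
      ultimately have "runs (F @ [?T]) ((S i)(Suc e := 0)) (S (Suc i))"
        by (rule runs_append)
      moreover have "(S i)(Suc e := 0) = (S i)(Suc e := S i (Suc e) - 1)" by (simp add: S_def)
      moreover have "S i (Suc e) \<noteq> 0" by (simp add: S_def)
      ultimately show ?case using runs_Loop_Suc step.IH by metis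
    qed
    then have 2: "runs [?L] (S 0) (s(e := n))" by simp
    have 3: "runs (assign d e (e + 3)) (s(e := n)) (s(e := n, d := n))"
      using runs_assign[of e "e + 3" d "s(e := n)"] d s by simp
    have "(s(e := n, d := n))(e := 0) = s(d := n)" using s d by auto
    then show ?thesis
      using runs_append[OF 1 runs_append[OF 2 runs_append[OF 3 runs_clear[of e]]]] by simp
  qed
  then show "\<exists>P. \<forall>s y. (\<forall>r\<ge>e. s r = 0) \<longrightarrow> rec_eval (Mu f) (map s srcs) y \<longrightarrow>
      runs P s (s(d := y))"
    by blast
qed

lemma programmable: "programmable f"
  by (induction f)
    (simp_all add: programmable_Zero programmable_Succ programmable_Proj programmable_Comp
      programmable_Prec programmable_Mu)


section \<open>Computing codes\<close>

definition recursive :: "nat \<Rightarrow> (nat list \<Rightarrow> nat) \<Rightarrow> bool" where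
  "recursive n h \<longleftrightarrow> (\<exists>f. \<forall>xs. length xs = n \<longrightarrow> rec_eval f xs (h xs))"

lemma recursiveI: "(\<And>xs. length xs = n \<Longrightarrow> rec_eval f xs (h xs)) \<Longrightarrow> recursive n h"
  unfolding recursive_def by blast

lemma recursive_proj: "i < n \<Longrightarrow> recursive n (\<lambda>xs. xs ! i)"
  by (rule recursiveI) (rule rec_eval.proj, simp)

lemma recursive_comp1:
  assumes "recursive (Suc 0) g" "recursive n h"
  shows "recursive n (\<lambda>xs. g [h xs])"
proof -
  obtain f f' where "\<forall>xs. length xs = Suc 0 \<longrightarrow> rec_eval f xs (g xs)"
    "\<forall>xs. length xs = n \<longrightarrow> rec_eval f' xs (h xs)"
    using assms unfolding recursive_def by blast
  then show ?thesis
    by (intro recursiveI[of n "Comp f [f']"]) (rule rec_eval.comp, auto)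
qed

lemma recursive_comp2:
  assumes "recursive 2 g" "recursive n h" "recursive n h'"
  shows "recursive n (\<lambda>xs. g [h xs, h' xs])"
proof -
  obtain f f1 f2 where "\<forall>xs. length xs = 2 \<longrightarrow> rec_eval f xs (g xs)"
    "\<forall>xs. length xs = n \<longrightarrow> rec_eval f1 xs (h xs)" "\<forall>xs. length xs = n \<longrightarrow> rec_eval f2 xs (h' xs)"
    using assms unfolding recursive_def by blast
  then show ?thesis
    by (intro recursiveI[of n "Comp f [f1, f2]"]) (rule rec_eval.comp, auto)
qed

lemma recursive_Suc: "recursive n h \<Longrightarrow> recursive n (\<lambda>xs. Suc (h xs))"
proof -
  have "recursive (Suc 0) (\<lambda>xs. Suc (hd xs))"
    by (rule recursiveI[of _ Succ]) (auto simp: length_Suc_conv intro: rec_eval.succ)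
  then show "recursive n h \<Longrightarrow> recursive n (\<lambda>xs. Suc (h xs))"
    using recursive_comp1 by fastforce
qed

lemma recursive_const: "recursive n (\<lambda>_. c)"
proof (induction c)
  case 0
  show ?case by (rule recursiveI) (rule rec_eval.zero)
qed (rule recursive_Suc)

lemma recursive_prec:
  assumes "recursive 1 b" "recursive 3 g"
    and "\<And>x. h 0 x = b [x]" and "\<And>k x. h (Suc k) x = g [k, h k x, x]"
  shows "recursive 2 (\<lambda>xs. h (xs ! 0) (xs ! 1))"
proof -
  obtain f f' where f: "\<forall>xs. length xs = 1 \<longrightarrow> rec_eval f xs (b xs)"
    "\<forall>xs. length xs = 3 \<longrightarrow> rec_eval f' xs (g xs)"
    using assms(1,2) unfolding recursive_def by blast
  have "rec_eval (Prec f f') [k, x] (h k x)" for k x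
  proof (induction k)
    case 0
    show ?case using f(1) by (auto simp: assms(3) intro: rec_eval.prec_0)
  next
    case (Suc k)
    show ?case using f(2) by (intro rec_eval.prec_Suc[OF Suc.IH]) (simp add: assms(4))
  qed
  then show ?thesis
    by (intro recursiveI[of _ "Prec f f'"]) (auto simp: numeral_2_eq_2 length_Suc_conv)
qed

text \<open>The first hypothesis expresses computability of \<open>G\<close> in the form that the
  closure rules prove directly. The iteration is a primitive recursion on the number of
  rounds.\<close>

lemma recursive_funpow:
  assumes "\<And>n h. recursive n h \<Longrightarrow> recursive n (\<lambda>xs. G (h xs))" "recursive n h" "recursive n h'"
  shows "recursive n (\<lambda>xs. (G ^^ h xs) (h' xs))"
proof -
  have "recursive 2 (\<lambda>xs. (G ^^ (xs ! 0)) (xs ! 1))"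
    by (rule recursive_prec[where b = "\<lambda>xs. xs ! 0" and g = "\<lambda>xs. G (xs ! 1)"])
      (auto intro!: recursive_proj assms(1))
  from recursive_comp2[OF this assms(2,3)] show ?thesis by simp
qed

lemma recursive_add:
  assumes "recursive n h" "recursive n h'"
  shows "recursive n (\<lambda>xs. h xs + h' xs)"
  using recursive_funpow[of Suc, OF recursive_Suc assms] by simp

lemma recursive_triangle:
  assumes "recursive n h"
  shows "recursive n (\<lambda>xs. triangle (h xs))"
proof -
  \<comment> \<open>The second argument is a dummy for the parameter of
    \<open>recursive_prec\<close>.\<close>
  have "recursive 2 (\<lambda>xs. triangle (xs ! 0))"
    by (rule recursive_prec[where b = "\<lambda>_. 0" and g = "\<lambda>xs. xs ! 1 + Suc (xs ! 0)"])
      (auto intro!: recursive_const recursive_add recursive_Suc recursive_proj)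
  from recursive_comp2[OF this assms assms] show ?thesis by simp
qed

lemma recursive_prod_encode:
  assumes "recursive n h" "recursive n h'"
  shows "recursive n (\<lambda>xs. prod_encode (h xs, h' xs))"
  unfolding prod_encode_def
  using recursive_add[OF recursive_triangle[OF recursive_add[OF assms]] assms(1)] by simp

lemma recursive_list_encode:
  "recursive n (\<lambda>xs. list_encode [])"
  "recursive n h \<Longrightarrow> recursive n (\<lambda>xs. list_encode (hs xs)) \<Longrightarrow>
    recursive n (\<lambda>xs. list_encode (h xs # hs xs))"
  by (simp_all add: recursive_const recursive_Suc recursive_prod_encode)

lemmas recursive_intros =
  recursive_list_encode recursive_prod_encode recursive_const recursive_proj recursive_funpow


section \<open>Counter programs on a cyclic tape\<close>

text \<open>These are the residual programs of a run, similar to the partial derivatives of a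
  regular expression: a loop body is only ever unfolded in front of its own loop. Their finiteness
  gives the head finitely many states.\<close>

fun reach :: "instr list \<Rightarrow> instr list set" where
  "reach [] = {[]}"
| "reach (Inc r # k) = insert (Inc r # k) (reach k)"
| "reach (Loop r c # k) = (\<lambda>c'. c' @ Loop r c # k) ` reach c \<union> reach k"

lemma finite_reach: "finite (reach P)"
  by (induction P rule: reach.induct) auto

lemma Nil_in_reach: "[] \<in> reach P"
  by (induction P rule: reach.induct) auto

lemma reach_refl: "P \<in> reach P"
proof (cases P rule: reach.cases)
  case (3 r c k)
  have "[] @ P \<in> (\<lambda>c'. c' @ Loop r c # k) ` reach c"
    unfolding 3 by (intro imageI Nil_in_reach)
  then show ?thesis by (simp add: 3)
qed auto

lemma reach_Inc: "Inc r # k \<in> reach P \<Longrightarrow> k \<in> reach P"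
  by (induction P arbitrary: k rule: reach.induct)
    (auto simp: reach_refl append_eq_Cons_conv Cons_eq_append_conv)

text \<open>This is closure under \<open>step\<close>. The loop at the front comes from the rest of
  the program, or it is the outer loop itself, or it lies in a residual of the outer body.\<close>

lemma reach_Loop: "Loop r c # k \<in> reach P \<Longrightarrow> k \<in> reach P \<and> c @ Loop r c # k \<in> reach P"
proof (induction P arbitrary: k rule: reach.induct)
  case (3 r' c' k')
  show ?case
  proof (cases "Loop r c # k \<in> reach k'")
    case True
    with 3 show ?thesis by auto
  next
    case False
    then obtain d where d: "d \<in> reach c'" "Loop r c # k = d @ Loop r' c' # k'"
      using 3 by auto
    show ?thesis
    proof (cases d)
      case Nil
      with d show ?thesis by (auto simp: reach_refl)
    next
      case (Cons a d')
      with d have "Loop r c # d' \<in> reach c'" "k = d' @ Loop r' c' # k'" by auto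
      with 3(1) show ?thesis by (fastforce simp: image_iff)
    qed
  qed
qed auto

text \<open>The tape is a cycle of cells behind a single \<open>Hash\<close>, read again and again by a head that
  only moves forward. Register \<open>r\<close> holds the number of cells with \<open>Sym (Suc r)\<close>,
  and \<open>Sym 0\<close> is a blank cell. One step of a program takes one round:
  in state \<open>Pend q\<close> the head looks for a cell to carry out the first instruction of \<open>q\<close>,
  in state \<open>Done q\<close> this has been accomplished. Reaching the end of the tape with a pending
  \<open>Inc\<close> is an overflow.\<close>

datatype state = Start | Pend "instr list" | Done "instr list"

datatype sym = Hash | Sym nat

context
  fixes P :: "instr list"
begin

text \<open>\<open>Start\<close> occurs only at time 0, and the round after it leaves the tape
  unchanged: the input is read in state \<open>Done P\<close>, whatever the first instruction is. A
  pending loop that meets \<open>Hash\<close> has found its register empty and is skipped.\<close>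

fun nxt :: "state \<times> sym \<Rightarrow> state" where
  "nxt (Start, x) = Done P"
| "nxt (Done q, Hash) = Pend q"
| "nxt (Done q, Sym x) = Done q"
| "nxt (Pend [], x) = Pend []"
| "nxt (Pend (Inc r # k), Hash) = Pend (Inc r # k)"
| "nxt (Pend (Inc r # k), Sym x) = (if x = 0 then Done k else Pend (Inc r # k))"
| "nxt (Pend (Loop r c # k), Hash) = Pend k"
| "nxt (Pend (Loop r c # k), Sym x) =
    (if x = Suc r then Done (c @ Loop r c # k) else Pend (Loop r c # k))"

fun wr :: "state \<times> sym \<Rightarrow> sym" where
  "wr (Pend (Inc r # k), Sym x) = (if x = 0 then Sym (Suc r) else Sym x)"
| "wr (Pend (Loop r c # k), Sym x) = (if x = Suc r then Sym 0 else Sym x)"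
| "wr (q, x) = x"

fun overflow :: "state \<times> sym \<Rightarrow> bool" where
  "overflow (Pend (Inc r # k), Hash) \<longleftrightarrow> True"
| "overflow _ \<longleftrightarrow> False"

section \<open>One round of the head over the tape\<close>

fun pass :: "state \<Rightarrow> sym list \<Rightarrow> state \<times> sym list" where
  "pass q [] = (q, [])"
| "pass q (x # xs) = (let (q', ys) = pass (nxt (q, x)) xs in (q', wr (q, x) # ys))"

lemma wr_Hash [simp]: "wr (q, x) = Hash \<longleftrightarrow> x = Hash"
  by (cases "(q, x)" rule: wr.cases) auto

lemma pass_Done: "Hash \<notin> set xs \<Longrightarrow> pass (Done q) xs = (Done q, xs)"
proof (induction xs)
  case (Cons x xs)
  then show ?case by (cases x) auto
qed simp

lemma pass_Nil: "pass (Pend []) xs = (Pend [], xs)"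
  by (induction xs) auto

text \<open>Only the first blank changes, after which \<open>pass_Done\<close> copies the rest.
  Indicators on both sides avoid subtraction of naturals.\<close>

lemma pass_Inc:
  assumes "Hash \<notin> set xs" "pass (Pend (Inc r # k)) xs = (q, ys)"
  shows "if Sym 0 \<in> set xs
    then q = Done k \<and> (\<forall>x. count_list ys x + (if x = Sym 0 then 1 else 0)
                          = count_list xs x + (if x = Sym (Suc r) then 1 else 0))
    else q = Pend (Inc r # k) \<and> ys = xs"
  using assms
proof (induction xs arbitrary: ys)
  case (Cons x xs)
  then obtain n where x: "x = Sym n" by (cases x) auto
  show ?case
  proof (cases "n = 0")
    case True
    then show ?thesis using Cons.prems x by (auto simp: pass_Done)
  next
    case False
    obtain zs where zs: "pass (Pend (Inc r # k)) xs = (q, zs)" "ys = Sym n # zs"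
      using Cons.prems x False by (auto split: prod.splits)
    have "Hash \<notin> set xs" using Cons.prems by simp
    note IH = Cons.IH[OF this zs(1)]
    show ?thesis
    proof (cases "Sym 0 \<in> set xs")
      case True
      with IH have c: "count_list zs y + (if y = Sym 0 then 1 else 0) =
          count_list xs y + (if y = Sym (Suc r) then 1 else 0)" for y
        by simp
      have "count_list ys y + (if y = Sym 0 then 1 else 0) =
          count_list (x # xs) y + (if y = Sym (Suc r) then 1 else 0)" for y
        using c[of y] by (auto simp: zs(2) x)
      then show ?thesis using IH True by simp
    next
      case nin: False
      then show ?thesis using IH x False by (simp add: zs(2))
    qed
  qed
qed simp

lemma pass_Loop:
  assumes "Hash \<notin> set xs" "pass (Pend (Loop r c # k)) xs = (q, ys)"
  shows "if Sym (Suc r) \<in> set xs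
    then q = Done (c @ Loop r c # k) \<and>
      (\<forall>x. count_list ys x + (if x = Sym (Suc r) then 1 else 0)
         = count_list xs x + (if x = Sym 0 then 1 else 0))
    else q = Pend (Loop r c # k) \<and> ys = xs"
  using assms
proof (induction xs arbitrary: ys)
  case (Cons x xs)
  then obtain n where x: "x = Sym n" by (cases x) auto
  show ?case
  proof (cases "n = Suc r")
    case True
    then show ?thesis using Cons.prems x by (auto simp: pass_Done)
  next
    case False
    obtain zs where zs: "pass (Pend (Loop r c # k)) xs = (q, zs)" "ys = Sym n # zs"
      using Cons.prems x False by (auto split: prod.splits)
    have "Hash \<notin> set xs" using Cons.prems by simp
    note IH = Cons.IH[OF this zs(1)]
    show ?thesis
    proof (cases "Sym (Suc r) \<in> set xs")
      case True
      with IH have c: "count_list zs y + (if y = Sym (Suc r) then 1 else 0) =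
          count_list xs y + (if y = Sym 0 then 1 else 0)" for y
        by simp
      have "count_list ys y + (if y = Sym (Suc r) then 1 else 0) =
          count_list (x # xs) y + (if y = Sym 0 then 1 else 0)" for y
        using c[of y] by (auto simp: zs(2) x)
      then show ?thesis using IH True by simp
    next
      case nin: False
      then show ?thesis using IH x False by (simp add: zs(2))
    qed
  qed
qed simp

text \<open>The counts of symbols are the registers, so a round without overflow performs one
  \<open>step\<close>. It uses up at most one blank, which later bounds the tape that a halting run
  requires.\<close>

lemma pass_step:
  assumes "Hash \<notin> set xs" "\<And>r. count_list xs (Sym (Suc r)) = s r"
    and "pass (Pend p) xs = (q, ys)" "step (p, s) = (p', s')"
    and "\<not> overflow (q, Hash)"
  shows "nxt (q, Hash) = Pend p' \<and> (\<forall>r. count_list ys (Sym (Suc r)) = s' r) \<and>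
    count_list xs (Sym 0) \<le> Suc (count_list ys (Sym 0))"
proof (cases p rule: reach.cases)
  case 1
  with assms show ?thesis by (auto simp: pass_Nil)
next
  case (2 r k)
  have s': "p' = k" "s' = s(r := Suc (s r))" using assms(4) 2 by auto
  note * = pass_Inc[OF assms(1) assms(3)[unfolded 2]]
  have "Sym 0 \<in> set xs" using * assms(5) by (auto split: if_splits)
  then have q: "q = Done k" and c: "\<And>x. count_list ys x + (if x = Sym 0 then 1 else 0)
      = count_list xs x + (if x = Sym (Suc r) then 1 else 0)"
    using * by auto
  have "count_list ys (Sym (Suc i)) = s' i" for i
    using c[of "Sym (Suc i)"] assms(2)[of i] s' by auto
  then show ?thesis using q s' c[of "Sym 0"] by auto
next
  case (3 r c k)
  note * = pass_Loop[OF assms(1) assms(3)[unfolded 3]]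
  show ?thesis
  proof (cases "s r = 0")
    case True
    then have "Sym (Suc r) \<notin> set xs" using assms(2)[of r] by (simp add: count_list_0_iff)
    then show ?thesis using * True assms 3 by auto
  next
    case False
    have s': "p' = c @ Loop r c # k" "s' = s(r := s r - 1)" using assms(4) 3 False by auto
    have "Sym (Suc r) \<in> set xs" using assms(2)[of r] False by (metis count_list_0_iff)
    then have q: "q = Done p'" and c: "\<And>x. count_list ys x + (if x = Sym (Suc r) then 1 else 0)
        = count_list xs x + (if x = Sym 0 then 1 else 0)"
      using * s' by auto
    have "count_list ys (Sym (Suc i)) = s' i" for i
      using c[of "Sym (Suc i)"] assms(2)[of i] s' by (auto split: if_splits)
    then show ?thesis using q c[of "Sym 0"] by auto
  qed
qed

text \<open>The state of the head at time \<open>i\<close> and the symbol that it reads, on a tape of length \<open>m\<close>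
  with initial contents \<open>u\<close>.\<close>

fun cell :: "nat \<Rightarrow> (nat \<Rightarrow> sym) \<Rightarrow> nat \<Rightarrow> state \<times> sym" where
  "cell m u i = (if i = 0 then Start else nxt (cell m u (i - 1)),
                 if i < m \<or> m = 0 then u i else wr (cell m u (i - m)))"

declare cell.simps [simp del]

lemma cell_0: "m > 0 \<Longrightarrow> cell m u 0 = (Start, u 0)"
  by (subst cell.simps) simp

lemma fst_cell_Suc: "fst (cell m u (Suc i)) = nxt (cell m u i)"
  by (subst cell.simps) simp

lemma snd_cell: "i < m \<Longrightarrow> snd (cell m u i) = u i"
  by (subst cell.simps) simp

lemma snd_cell_add: "m > 0 \<Longrightarrow> snd (cell m u (i + m)) = wr (cell m u i)"
  by (subst cell.simps) simp

section \<open>The whole computation, round by round\<close>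

lemma pass_cells:
  assumes "m > 0"
  shows "pass (fst (cell m u i)) (map (\<lambda>j. snd (cell m u j)) [i..<i + n]) =
    (fst (cell m u (i + n)), map (\<lambda>j. snd (cell m u j)) [i + m..<i + n + m])"
proof (induction n arbitrary: i)
  case (Suc n)
  have *: "[i..<i + Suc n] = i # [Suc i..<Suc i + n]" "[i + m..<i + Suc n + m] = (i + m) # [Suc i + m..<Suc i + n + m]"
    by (simp_all add: upt_conv_Cons)
  show ?case unfolding * using Suc[of "Suc i"] assms
    by (simp add: fst_cell_Suc snd_cell_add)
qed simp

context
  fixes m :: nat and u :: "nat \<Rightarrow> sym"
  assumes m: "m > 0" and u0: "u 0 = Hash" and u: "\<And>i. 0 < i \<Longrightarrow> i < m \<Longrightarrow> u i \<noteq> Hash"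
begin

definition row :: "nat \<Rightarrow> sym list" where
  "row k = map (\<lambda>j. snd (cell m u j)) [Suc (k * m)..<Suc (k * m) + (m - 1)]"

text \<open>True of the first \<open>m\<close> cells by the choice of \<open>u\<close>, and
  preserved because \<open>wr\<close> neither erases nor creates \<open>Hash\<close>.\<close>

lemma snd_cell_Hash: "snd (cell m u i) = Hash \<longleftrightarrow> m dvd i"
proof (induction i rule: less_induct)
  case (less i)
  show ?case
  proof (cases "i < m")
    case True
    then show ?thesis using u0 u[of i] by (cases "i = 0") (auto simp: snd_cell dest: dvd_imp_le)
  next
    case False
    then obtain j where j: "i = j + m" by (metis add.commute le_Suc_ex not_less)
    obtain q x where "cell m u j = (q, x)" by (cases "cell m u j")
    then show ?thesis using less[of j] j m by (simp add: snd_cell_add)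
  qed
qed

lemma Hash_row: "Hash \<notin> set (row k)"
proof -
  have "\<not> m dvd j" if "j \<in> set [Suc (k * m)..<Suc (k * m) + (m - 1)]" for j
  proof
    assume "m dvd j"
    then have "m dvd j - k * m" by (simp add: dvd_diff_nat)
    moreover have "0 < j - k * m" "j - k * m < m" using that by auto
    ultimately show False by (auto dest: dvd_imp_le)
  qed
  then show ?thesis unfolding row_def set_map image_iff by (metis snd_cell_Hash)
qed

lemma pass_row:
  "pass (fst (cell m u (Suc (k * m)))) (row k) = (fst (cell m u (Suc k * m)), row (Suc k))"
proof -
  have "Suc (k * m) + (m - 1) = Suc k * m" "Suc (k * m) + m = Suc (Suc k * m)"
    "Suc k * m + m = Suc (Suc k * m) + (m - 1)" using m by auto
  then show ?thesis unfolding row_def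
    using pass_cells[OF m, of u "Suc (k * m)" "m - 1"] by (simp add: ac_simps)
qed

lemma row_0: "row 0 = map u [1..<m]"
  using m unfolding row_def by (simp add: snd_cell)

lemma cell_row_start: "cell m u (k * m) = (fst (cell m u (k * m)), Hash)"
  using snd_cell_Hash[of "k * m"] by (simp add: prod_eq_iff)

lemma row_1: "fst (cell m u (Suc m)) = Pend P" "row 1 = row 0" "\<not> overflow (cell m u m)"
proof -
  have "fst (cell m u (Suc (0 * m))) = Done P"
    by (simp add: fst_cell_Suc cell_0 m)
  then have *: "fst (cell m u m) = Done P \<and> row 1 = row 0"
    using pass_row[of 0] pass_Done[OF Hash_row[of 0]] by simp
  then have **: "cell m u m = (Done P, Hash)" using cell_row_start[of 1] by simp
  from * show "row 1 = row 0" ..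
  from ** show "fst (cell m u (Suc m)) = Pend P" "\<not> overflow (cell m u m)"
    by (simp_all add: fst_cell_Suc)
qed

lemma overflow_cell: "overflow (cell m u i) \<Longrightarrow> \<exists>k>0. i = Suc k * m"
proof -
  assume *: "overflow (cell m u i)"
  then have "snd (cell m u i) = Hash" by (cases "cell m u i" rule: overflow.cases) auto
  then obtain k where k: "i = k * m" unfolding snd_cell_Hash by (metis dvd_div_mult_self)
  have "k \<noteq> 0" using * k by (intro notI) (simp add: cell_0[OF m])
  moreover have "k \<noteq> 1" using * k row_1(3) by auto
  ultimately show ?thesis using k by (intro exI[of _ "k - 1"]) auto
qed

text \<open>Round 0 only copies, so step \<open>j\<close> of the program happens in round
  \<open>Suc j\<close>, and its overflow would show at the \<open>Hash\<close> that ends this round,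
  at time \<open>Suc (Suc j) * m\<close>.\<close>

lemma row_step:
  assumes s: "\<And>r. count_list (row 0) (Sym (Suc r)) = s r"
    and "\<And>j. j < k \<Longrightarrow> \<not> overflow (cell m u (Suc (Suc j) * m))"
    and "(step ^^ k) (P, s) = (q, t)"
  shows "fst (cell m u (Suc (Suc k * m))) = Pend q \<and>
    (\<forall>r. count_list (row (Suc k)) (Sym (Suc r)) = t r) \<and>
    count_list (row 0) (Sym 0) \<le> count_list (row (Suc k)) (Sym 0) + k"
  using assms(2,3)
proof (induction k arbitrary: q t)
  case 0
  then show ?case using s row_1 by auto
next
  case (Suc k)
  obtain q0 t0 where q0: "(step ^^ k) (P, s) = (q0, t0)" by (cases "(step ^^ k) (P, s)")
  with Suc.prems(2) have st: "step (q0, t0) = (q, t)" by simp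
  have IH: "fst (cell m u (Suc (Suc k * m))) = Pend q0"
    "\<And>r. count_list (row (Suc k)) (Sym (Suc r)) = t0 r"
    "count_list (row 0) (Sym 0) \<le> count_list (row (Suc k)) (Sym 0) + k"
    using Suc.IH[OF _ q0] Suc.prems(1) by auto
  note c = cell_row_start[of "Suc (Suc k)"]
  have "\<not> overflow (fst (cell m u (Suc (Suc k) * m)), Hash)"
    using Suc.prems(1)[of k] c by simp
  from pass_step[OF Hash_row IH(2) _ st this, of "row (Suc (Suc k))"]
  have "nxt (fst (cell m u (Suc (Suc k) * m)), Hash) = Pend q"
    "\<And>r. count_list (row (Suc (Suc k))) (Sym (Suc r)) = t r"
    "count_list (row (Suc k)) (Sym 0) \<le> Suc (count_list (row (Suc (Suc k))) (Sym 0))"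
    using pass_row[of "Suc k"] IH(1) by auto
  then show ?case using IH(3) c by (auto simp: fst_cell_Suc)
qed

text \<open>Without overflow the rows would follow the run forever, but a row has only
  \<open>m - 1\<close> cells to represent a register.\<close>

lemma overflowI:
  assumes "\<And>r. count_list (row 0) (Sym (Suc r)) = s r"
    and "m \<le> snd ((step ^^ k) (P, s)) r"
  shows "\<exists>i. overflow (cell m u i)"
proof (rule ccontr)
  assume "\<not> ?thesis"
  then have "count_list (row (Suc k)) (Sym (Suc r)) = snd ((step ^^ k) (P, s)) r"
    using row_step[OF assms(1), of k] by (metis prod.collapse)
  moreover have "count_list (row (Suc k)) (Sym (Suc r)) \<le> length (row (Suc k))"
    by (rule count_le_length)
  ultimately show False using assms(2) m by (simp add: row_def)
qed

text \<open>Each step takes at most one blank, so before step \<open>T\<close> an \<open>Inc\<close>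
  still finds one; from step \<open>T\<close> on the program is empty, and \<open>Pend []\<close>
  never overflows.\<close>

lemma not_overflowI:
  assumes s: "\<And>r. count_list (row 0) (Sym (Suc r)) = s r"
    and halt: "(step ^^ T) (P, s) = ([], t)" and T: "T < count_list (row 0) (Sym 0)"
  shows "\<not> overflow (cell m u i)"
proof
  \<comment> \<open>Strong induction, because \<open>row_step\<close> presupposes that no earlier
    round has overflowed.\<close>
  have no: "\<not> overflow (cell m u (Suc (Suc k) * m))" for k
  proof (induction k rule: less_induct)
    case (less k)
    obtain q t' where q: "(step ^^ k) (P, s) = (q, t')" by (cases "(step ^^ k) (P, s)")
    note R = row_step[OF s less.IH q, simplified]
    show ?case
    proof
      assume o: "overflow (cell m u (Suc (Suc k) * m))"
      note c = cell_row_start[of "Suc (Suc k)"]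
      from o c obtain r p where p: "fst (cell m u (Suc (Suc k) * m)) = Pend (Inc r # p)"
        by (cases "cell m u (Suc (Suc k) * m)" rule: overflow.cases) auto
      have pass: "pass (Pend q) (row (Suc k)) = (Pend (Inc r # p), row (Suc (Suc k)))"
        using pass_row[of "Suc k"] R p by simp
      have "k < T"
      proof (rule ccontr)
        assume "\<not> k < T"
        then have "(step ^^ k) (P, s) = (step ^^ (k - T)) ((step ^^ T) (P, s))"
          by (metis funpow_add le_add_diff_inverse2 not_less o_apply)
        also have "(step ^^ n) ([], t) = ([], t)" for n
          by (induction n) simp_all
        then have "(step ^^ (k - T)) ((step ^^ T) (P, s)) = ([], t)" by (simp add: halt)
        finally have "q = []" using q by simp
        then show False using pass by (simp add: pass_Nil)
      qed
      then have "count_list (row (Suc k)) (Sym 0) \<noteq> 0" using R T by auto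
      then have blank: "Sym 0 \<in> set (row (Suc k))" by (metis count_list_0_iff)
      show False
      proof (cases q rule: reach.cases)
        case 1
        then show ?thesis using pass by (simp add: pass_Nil)
      next
        case 2
        then show ?thesis using pass pass_Inc[OF Hash_row] blank by fastforce
      next
        case 3
        then show ?thesis using pass pass_Loop[OF Hash_row] by (fastforce split: if_splits)
      qed
    qed
  qed
  assume "overflow (cell m u i)"
  from this overflow_cell[OF this] show False using no by (metis Suc_pred')
qed

text \<open>This deals with tapes too short for the input, whose registers do not hold the intended
  values: a leading \<open>Inc\<close> overflows before anything is computed.\<close>

lemma overflow_full:
  assumes "P = Inc r # k" "Sym 0 \<notin> set (row 0)"
  shows "\<exists>i. overflow (cell m u i)"
proof -
  have "pass (Pend P) (row 1) = (fst (cell m u (2 * m)), row 2)"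
    using pass_row[of 1] row_1(1) by (simp add: numeral_2_eq_2)
  then have "fst (cell m u (2 * m)) = Pend (Inc r # k)"
    using pass_Inc[OF Hash_row[of 0]] assms row_1(2) by auto
  then have "overflow (cell m u (2 * m))" using cell_row_start[of 2] by simp
  then show ?thesis by blast
qed

end

end


section \<open>Tapes in metric temporal logic\<close>

text \<open>The syntax has no constants, so some letter must occur; \<open>0\<close> lies in every
  alphabet \<open>{0..<N}\<close> with \<open>N > 0\<close>.\<close>

definition Tru :: "nat mtl" where
  "Tru = Neg (Conj (Letter 0) (Neg (Letter 0)))"

definition Disj :: "nat mtl \<Rightarrow> nat mtl \<Rightarrow> nat mtl" where
  "Disj \<phi> \<psi> = Neg (Conj (Neg \<phi>) (Neg \<psi>))"

text \<open>\<open>Until\<close> is strict and its left argument is false, so no position can lie in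
  between.\<close>

definition Next :: "nat mtl \<Rightarrow> nat mtl" where
  "Next \<phi> = Until (Ivl (Incl 0) None) (Neg Tru) \<phi>"

definition Ev :: "ivl \<Rightarrow> nat mtl \<Rightarrow> nat mtl" where
  "Ev I \<phi> = Until I Tru \<phi>"

definition Alw :: "nat mtl \<Rightarrow> nat mtl" where
  "Alw \<phi> = Conj \<phi> (Neg (Ev (Ivl (Incl 0) None) (Neg \<phi>)))"

definition unit_ivl :: ivl where
  "unit_ivl = Ivl (Incl 1) (Some (Incl 1))"

definition one_of :: "nat list \<Rightarrow> nat mtl" where
  "one_of as = foldr (\<lambda>a. Disj (Letter a)) as (Neg Tru)"

definition conjs :: "nat mtl list \<Rightarrow> nat mtl" where
  "conjs \<phi>s = foldr Conj \<phi>s Tru"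

text \<open>This will be the language of \<open>ticks N\<close> at the value \<open>p\<close>; the
  first event happens at time \<open>p\<close>.\<close>

definition words :: "nat \<Rightarrow> real \<Rightarrow> nat tword set" where
  "words N p = {w. w \<noteq> [] \<and> (\<forall>i<length w. fst (w ! i) < N \<and> snd (w ! i) = real (Suc i) * p)}"

lemma msat_basic [simp]:
  "msat w i Tru"
  "msat w i (Disj \<phi> \<psi>) \<longleftrightarrow> msat w i \<phi> \<or> msat w i \<psi>"
  "msat w i (one_of as) \<longleftrightarrow> fst (w ! i) \<in> set as"
  "msat w i (conjs \<phi>s) \<longleftrightarrow> (\<forall>\<phi>\<in>set \<phi>s. msat w i \<phi>)"
proof -
  show 1: "msat w i Tru" unfolding Tru_def by auto
  show 2: "msat w i (Disj \<phi> \<psi>) \<longleftrightarrow> msat w i \<phi> \<or> msat w i \<psi>" for \<phi> \<psi> by (simp add: Disj_def)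
  show "msat w i (one_of as) \<longleftrightarrow> fst (w ! i) \<in> set as"
    unfolding one_of_def by (induction as) (auto simp: 1 2)
  show "msat w i (conjs \<phi>s) \<longleftrightarrow> (\<forall>\<phi>\<in>set \<phi>s. msat w i \<phi>)"
    unfolding conjs_def by (induction \<phi>s) (auto simp: 1)
qed

lemma letters_basic:
  "letters Tru = {0}"
  "letters (Disj \<phi> \<psi>) = letters \<phi> \<union> letters \<psi>"
  "letters (Next \<phi>) = insert 0 (letters \<phi>)"
  "letters (Ev I \<phi>) = insert 0 (letters \<phi>)"
  "letters (Alw \<phi>) = insert 0 (letters \<phi>)"
  "letters (one_of as) = insert 0 (set as)"
  "letters (conjs \<phi>s) = insert 0 (\<Union>\<phi>\<in>set \<phi>s. letters \<phi>)"
proof -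
  show 1: "letters Tru = {0}" by (simp add: Tru_def)
  show 2: "letters (Disj \<phi> \<psi>) = letters \<phi> \<union> letters \<psi>" for \<phi> \<psi> by (simp add: Disj_def)
  show "letters (one_of as) = insert 0 (set as)"
    unfolding one_of_def by (induction as) (auto simp: 1 2)
  show "letters (conjs \<phi>s) = insert 0 (\<Union>\<phi>\<in>set \<phi>s. letters \<phi>)"
    unfolding conjs_def by (induction \<phi>s) (auto simp: 1)
qed (auto simp: Next_def Ev_def Alw_def Tru_def)

lemma words_diff:
  assumes "w \<in> words N p" "i \<le> j" "j < length w"
  shows "snd (w ! j) - snd (w ! i) = real (j - i) * p"
  using assms unfolding words_def by (simp add: of_nat_diff algebra_simps)

lemma msat_Ev:
  assumes "w \<in> words N p"
  shows "msat w i (Ev I \<phi>) \<longleftrightarrow>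
    (\<exists>j>i. j < length w \<and> real (j - i) * p \<in> ivl_set I \<and> msat w j \<phi>)"
  unfolding Ev_def using words_diff[OF assms, of i] by auto

lemma msat_Next:
  assumes "w \<in> words N p" "p \<ge> 0"
  shows "msat w i (Next \<phi>) \<longleftrightarrow> Suc i < length w \<and> msat w (Suc i) \<phi>"
proof
  assume "msat w i (Next \<phi>)"
  then obtain j where j: "i < j" "j < length w" "msat w j \<phi>" "\<forall>k. i < k \<longrightarrow> \<not> k < j"
    unfolding Next_def by auto
  then have "j = Suc i" by (metis Suc_lessI lessI)
  with j show "Suc i < length w \<and> msat w (Suc i) \<phi>" by simp
next
  assume "Suc i < length w \<and> msat w (Suc i) \<phi>"
  then show "msat w i (Next \<phi>)"
    unfolding Next_def using words_diff[OF assms(1), of i "Suc i"] assms(2)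
    by (auto intro!: exI[of _ "Suc i"])
qed

lemma msat_Alw:
  assumes "w \<in> words N p" "p \<ge> 0"
  shows "msat w 0 (Alw \<phi>) \<longleftrightarrow> (\<forall>i<length w. msat w i \<phi>)"
proof -
  have "msat w 0 (Alw \<phi>) \<longleftrightarrow> msat w 0 \<phi> \<and> (\<forall>i>0. i < length w \<longrightarrow> msat w i \<phi>)"
    unfolding Alw_def using assms(2) by (auto simp: msat_Ev[OF assms(1)])
  moreover have "w \<noteq> []" using assms(1) by (simp add: words_def)
  ultimately show ?thesis by (metis length_greater_0_conv neq0_conv)
qed

lemma msat_Ev_unit:
  assumes "w \<in> words N (1 / real m)" "m > 0"
  shows "msat w i (Ev unit_ivl \<phi>) \<longleftrightarrow> i + m < length w \<and> msat w (i + m) \<phi>"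
proof -
  have "i < j \<and> real (j - i) * (1 / real m) \<in> ivl_set unit_ivl \<longleftrightarrow> j = i + m" for j
    using assms(2) by (auto simp: unit_ivl_def field_simps of_nat_diff)
  then show ?thesis unfolding msat_Ev[OF assms(1)] by metis
qed

text \<open>The double negations make both constraints weak: nothing is demanded where the word has
  ended.\<close>

definition neighbours :: "nat \<Rightarrow> (nat \<Rightarrow> nat \<Rightarrow> bool) \<Rightarrow> (nat \<Rightarrow> nat \<Rightarrow> bool) \<Rightarrow> nat \<Rightarrow> nat mtl" where
  "neighbours N R R' a = Disj (Neg (Letter a))
     (Conj (Neg (Next (Neg (one_of (filter (R a) [0..<N])))))
           (Neg (Ev unit_ivl (Neg (one_of (filter (R' a) [0..<N]))))))"

text \<open>Intended are \<open>H\<close> for the letters with \<open>Hash\<close>, \<open>R\<close>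
  for the next state, \<open>R'\<close> for the same cell one round later, and \<open>F\<close> for
  overflow. \<open>Hash\<close> is excluded explicitly only from the rest of the first round, since
  \<open>R'\<close> carries the tape along.\<close>

definition tape_formula ::
  "nat \<Rightarrow> (nat \<Rightarrow> bool) \<Rightarrow> (nat \<Rightarrow> nat \<Rightarrow> bool) \<Rightarrow> (nat \<Rightarrow> nat \<Rightarrow> bool) \<Rightarrow> (nat \<Rightarrow> bool) \<Rightarrow> nat mtl" where
  "tape_formula N H R R' F = conjs
     [Letter 0, Neg (Ev (Ivl (Excl 0) (Some (Excl 1))) (one_of (filter H [0..<N]))),
      Alw (conjs (map (neighbours N R R') [0..<N])), Ev (Ivl (Incl 0) None) (one_of (filter F [0..<N]))]"

lemma letters_tape_formula:
  "N > 0 \<Longrightarrow> letters (tape_formula N H R R' F) \<subseteq> {0..<N}"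
  unfolding tape_formula_def neighbours_def by (auto simp: letters_basic)

lemma msat_neighbours:
  assumes "w \<in> words N (1 / real m)" "m > 0" "i < length w"
  shows "(\<forall>a<N. msat w i (neighbours N R R' a)) \<longleftrightarrow>
    (Suc i < length w \<longrightarrow> R (fst (w ! i)) (fst (w ! Suc i))) \<and>
    (i + m < length w \<longrightarrow> R' (fst (w ! i)) (fst (w ! (i + m))))"
proof -
  have "fst (w ! j) < N" if "j < length w" for j
    using assms(1) that by (simp add: words_def)
  then show ?thesis using assms(3)
    by (auto simp: neighbours_def msat_Next[OF assms(1)] msat_Ev_unit[OF assms(1,2)])
qed

lemma msat_tape_formula:
  assumes "w \<in> words N (1 / real m)" "m > 0"
  shows "msat w 0 (tape_formula N H R R' F) \<longleftrightarrow>
    fst (w ! 0) = 0 \<and>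
    (\<forall>i. 0 < i \<and> i < m \<and> i < length w \<longrightarrow> \<not> H (fst (w ! i))) \<and>
    (\<forall>i. Suc i < length w \<longrightarrow> R (fst (w ! i)) (fst (w ! Suc i))) \<and>
    (\<forall>i. i + m < length w \<longrightarrow> R' (fst (w ! i)) (fst (w ! (i + m)))) \<and>
    (\<exists>i. 0 < i \<and> i < length w \<and> F (fst (w ! i)))"
proof -
  have N: "fst (w ! j) < N" if "j < length w" for j
    using assms(1) that by (simp add: words_def)
  have 1: "msat w 0 (Ev (Ivl (Excl 0) (Some (Excl 1))) (one_of (filter H [0..<N]))) \<longleftrightarrow>
    (\<exists>i. 0 < i \<and> i < m \<and> i < length w \<and> H (fst (w ! i)))"
    using N assms(2) by (auto simp: msat_Ev[OF assms(1)] field_simps)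
  have 2: "msat w 0 (Alw (conjs (map (neighbours N R R') [0..<N]))) \<longleftrightarrow>
    (\<forall>i. Suc i < length w \<longrightarrow> R (fst (w ! i)) (fst (w ! Suc i))) \<and>
    (\<forall>i. i + m < length w \<longrightarrow> R' (fst (w ! i)) (fst (w ! (i + m))))"
  proof -
    have "msat w 0 (Alw (conjs (map (neighbours N R R') [0..<N]))) \<longleftrightarrow>
      (\<forall>i<length w. \<forall>a<N. msat w i (neighbours N R R' a))"
      by (subst msat_Alw[OF assms(1)]) (auto simp: Ball_def)
    then show ?thesis using msat_neighbours[OF assms, of _ R R'] by (auto simp: Suc_lessD)
  qed
  have 3: "msat w 0 (Ev (Ivl (Incl 0) None) (one_of (filter F [0..<N]))) \<longleftrightarrow>
    (\<exists>i. 0 < i \<and> i < length w \<and> F (fst (w ! i)))"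
    using N by (auto simp: msat_Ev[OF assms(1)])
  show ?thesis unfolding tape_formula_def
    by (simp only: msat_basic(4) list.set ball_simps msat.simps 1 2 3) auto
qed

text \<open>The letters \<open>0, \<dots>, 4\<close> have the same meaning for all programs, see \<open>init_letters\<close> below.
  In this way \<open>input_formula\<close> does not depend on the program and its code is computable from
  the input. Letter 1 is the end of the tape, where the input is cut off.\<close>

definition load :: "nat \<Rightarrow> nat mtl \<Rightarrow> nat mtl" where
  "load c \<phi> = Next (Disj (Letter 1) (Conj (Letter c) \<phi>))"

lemma msat_load:
  assumes "w \<in> words N p" "p \<ge> 0"
  shows "msat w i (load c \<phi>) \<longleftrightarrow> Suc i < length w \<and>
    (fst (w ! Suc i) = 1 \<or> fst (w ! Suc i) = c \<and> msat w (Suc i) \<phi>)"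
  unfolding load_def msat_Next[OF assms] by simp

lemma loadD:
  assumes w: "w \<in> words N p" "p \<ge> 0"
    and "msat w i ((load c ^^ n) \<phi>)" "\<And>j. i < j \<Longrightarrow> j \<le> i + n \<Longrightarrow> j < length w \<Longrightarrow> fst (w ! j) \<noteq> 1"
  shows "(\<forall>j. i < j \<and> j \<le> i + n \<longrightarrow> fst (w ! j) = c) \<and> msat w (i + n) \<phi>"
  using assms(3,4)
proof (induction n arbitrary: i)
  case (Suc n)
  from Suc.prems(1) have i: "Suc i < length w"
    and "fst (w ! Suc i) = 1 \<or> fst (w ! Suc i) = c \<and> msat w (Suc i) ((load c ^^ n) \<phi>)"
    by (auto simp: msat_load[OF w])
  with Suc.prems(2)[of "Suc i"] have *: "fst (w ! Suc i) = c" "msat w (Suc i) ((load c ^^ n) \<phi>)"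
    by auto
  have "(\<forall>j. Suc i < j \<and> j \<le> Suc i + n \<longrightarrow> fst (w ! j) = c) \<and> msat w (Suc i + n) \<phi>"
    using Suc.prems(2) by (intro Suc.IH[OF *(2)]) auto
  with *(1) show ?case by (metis Suc_lessI add_Suc add_Suc_right)
qed auto

text \<open>If the chain reaches \<open>m\<close>, the alternative \<open>Letter 1\<close> in
  \<open>load\<close> ends it there, and nothing is required of \<open>\<phi>\<close>.\<close>

lemma loadI:
  assumes w: "w \<in> words N p" "p \<ge> 0" and m: "m < length w" "fst (w ! m) = 1"
    and "i < m" "\<And>j. i < j \<Longrightarrow> j \<le> i + n \<Longrightarrow> j < m \<Longrightarrow> fst (w ! j) = c"
    and "i + n < m \<Longrightarrow> msat w (i + n) \<phi>"
  shows "msat w i ((load c ^^ n) \<phi>)"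
  using assms(5-)
proof (induction n arbitrary: i)
  case (Suc n)
  show ?case
  proof (cases "Suc i = m")
    case True
    then show ?thesis using m by (simp add: msat_load[OF w])
  next
    case False
    then have "msat w (Suc i) ((load c ^^ n) \<phi>)"
      using Suc.prems by (intro Suc.IH) auto
    then show ?thesis using False m Suc.prems(1) Suc.prems(2)[of "Suc i"]
      by (simp add: msat_load[OF w])
  qed
qed auto

definition input_formula :: "nat \<Rightarrow> nat \<Rightarrow> nat mtl" where
  "input_formula a b =
     (load 2 ^^ a) ((load 3 ^^ b) (Until (Ivl (Incl 0) None) (Letter 4) (Letter 1)))"

lemma letters_input_formula: "letters (input_formula a b) \<subseteq> {0..<5}"
proof -
  have *: "letters ((load c ^^ n) \<phi>) \<subseteq> {0..<5}" if "letters \<phi> \<subseteq> {0..<5}" "c < 5" for c n \<phi>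
    using that by (induction n) (auto simp: load_def letters_basic)
  show ?thesis unfolding input_formula_def by (intro *) auto
qed

definition initial_tape :: "nat \<Rightarrow> nat \<Rightarrow> nat \<Rightarrow> sym" where
  "initial_tape a b i =
     (if i = 0 then Hash else if i \<le> a then Sym 1 else if i \<le> a + b then Sym 2 else Sym 0)"

definition init_letters :: "instr list \<Rightarrow> (state \<times> sym) list" where
  "init_letters P = [(Start, Hash), (Done P, Hash), (Done P, Sym 1), (Done P, Sym 2), (Done P, Sym 0)]"

lemma input_formulaD:
  assumes w: "w \<in> words N p" "p \<ge> 0" and i: "msat w 0 (input_formula a b)"
    and no: "\<And>j. 0 < j \<Longrightarrow> j < m \<Longrightarrow> j < length w \<Longrightarrow> fst (w ! j) \<noteq> 1"
    and "a + b < m" "0 < j" "j < m"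
  shows "fst (w ! j) < 5 \<and> snd (init_letters P ! fst (w ! j)) = initial_tape a b j"
proof -
  have 1: "(\<forall>j. 0 < j \<and> j \<le> a \<longrightarrow> fst (w ! j) = 2) \<and>
      msat w a ((load 3 ^^ b) (Until (Ivl (Incl 0) None) (Letter 4) (Letter 1)))"
    using loadD[OF w i[unfolded input_formula_def]] no assms(5) by simp
  then have 2: "(\<forall>j. a < j \<and> j \<le> a + b \<longrightarrow> fst (w ! j) = 3) \<and>
      msat w (a + b) (Until (Ivl (Incl 0) None) (Letter 4) (Letter 1))"
    using no assms(5) by (intro loadD[OF w]) auto
  then obtain k where k: "a + b < k" "k < length w" "fst (w ! k) = 1"
    "\<And>j. a + b < j \<Longrightarrow> j < k \<Longrightarrow> fst (w ! j) = 4" by auto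
  \<comment> \<open>The \<open>Until\<close> ends at an occurrence of letter 1, which
    \<open>no\<close> excludes before \<open>m\<close>; hence the blanks extend to the end of the
    tape.\<close>
  have "m \<le> k" using no[of k] k by (cases "k < m") auto
  then have 3: "\<And>j. a + b < j \<Longrightarrow> j < m \<Longrightarrow> fst (w ! j) = 4" using k by simp
  consider "j \<le> a" | "a < j" "j \<le> a + b" | "a + b < j" by linarith
  then show ?thesis
    using 1 2 3[of j] assms(6,7) by cases (auto simp: init_letters_def initial_tape_def numeral_eq_Suc)
qed

lemma input_formulaI:
  assumes w: "w \<in> words N p" "p \<ge> 0" and m: "0 < m" "m < length w" "fst (w ! m) = 1"
    and l: "\<And>j. 0 < j \<Longrightarrow> j < m \<Longrightarrow>
      fst (w ! j) < length ls \<and> ls ! fst (w ! j) = (Done P, initial_tape a b j)"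
    and ls: "distinct ls" "\<And>i. i < 5 \<Longrightarrow> i < length ls \<and> ls ! i = init_letters P ! i"
  shows "msat w 0 (input_formula a b)"
proof -
  \<comment> \<open>As \<open>ls\<close> is distinct, a letter is determined by the state and the
    symbol that it stands for.\<close>
  have l': "fst (w ! j) = i"
    if "i < 5" "init_letters P ! i = (Done P, initial_tape a b j)" "0 < j" "j < m" for i j
    using l[OF that(3,4)] ls(2)[OF that(1)] that(2) nth_eq_iff_index_eq[OF ls(1)] by metis
  have 2: "fst (w ! j) = 2" if "0 < j" "j \<le> a" "j < m" for j
    using that by (intro l') (auto simp: init_letters_def initial_tape_def numeral_eq_Suc)
  have 3: "fst (w ! j) = 3" if "a < j" "j \<le> a + b" "j < m" for j
    using that by (intro l') (auto simp: init_letters_def initial_tape_def numeral_eq_Suc)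
  have 4: "fst (w ! j) = 4" if "a + b < j" "j < m" for j
    using that by (intro l') (auto simp: init_letters_def initial_tape_def numeral_eq_Suc)
  have 5: "msat w (a + b) (Until (Ivl (Incl 0) None) (Letter 4) (Letter 1))" if "a + b < m"
  proof -
    have "0 \<le> snd (w ! m) - snd (w ! (a + b))"
      using words_diff[OF w(1), of "a + b" m] w(2) that m(2) by simp
    then show ?thesis using that m 4 by (auto intro!: exI[of _ m])
  qed
  have "msat w a ((load 3 ^^ b) (Until (Ivl (Incl 0) None) (Letter 4) (Letter 1)))" if "a < m"
    by (rule loadI[OF w m(2,3) that 3 5])
  then show ?thesis unfolding input_formula_def
    by (intro loadI[OF w m(2,3,1) 2]) auto
qed


section \<open>The formula of a program\<close>

lemma row_initial_tape:
  assumes "a + b < m"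
  shows "map (initial_tape a b) [1..<m] =
    replicate a (Sym 1) @ replicate b (Sym 2) @ replicate (m - 1 - a - b) (Sym 0)"
  using assms by (intro nth_equalityI) (auto simp: nth_append initial_tape_def)

lemma count_list_replicate: "count_list (replicate n x) y = (if x = y then n else 0)"
  by (induction n) auto

lemma initial_row:
  assumes "a + b < m"
  shows "count_list (row P m (initial_tape a b) 0) (Sym (Suc r)) = ((\<lambda>_. 0)(0 := a, 1 := b)) r"
    and "count_list (row P m (initial_tape a b) 0) (Sym 0) = m - 1 - a - b"
proof -
  have *: "row P m (initial_tape a b) 0 = map (initial_tape a b) [1..<m]"
    using assms by (intro row_0) (auto simp: initial_tape_def)
  show "count_list (row P m (initial_tape a b) 0) (Sym (Suc r)) = ((\<lambda>_. 0)(0 := a, 1 := b)) r"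
    "count_list (row P m (initial_tape a b) 0) (Sym 0) = m - 1 - a - b"
    unfolding * row_initial_tape[OF assms] by (auto simp: count_list_replicate)
qed

lemma initial_row_full:
  assumes "m \<le> a + b" "m > 0"
  shows "Sym 0 \<notin> set (row P m (initial_tape a b) 0)"
proof -
  have "row P m (initial_tape a b) 0 = map (initial_tape a b) [1..<m]"
    using assms by (intro row_0) (auto simp: initial_tape_def)
  then show ?thesis using assms by (auto simp: initial_tape_def)
qed

text \<open>The table lists a full product of states and symbols, so that closure under
  \<open>nxt\<close> and closure under \<open>wr\<close> are separate conditions. It starts with
  \<open>init_letters\<close>, which fixes the letters \<open>0\<close> to \<open>4\<close>.\<close>

lemma letter_table:
  obtains ls where "distinct ls" "\<And>i. i < 5 \<Longrightarrow> i < length ls \<and> ls ! i = init_letters P ! i"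
    and "\<And>l x. l \<in> set ls \<Longrightarrow> (nxt P l, x) \<in> set ls \<longleftrightarrow> x \<in> snd ` set ls"
    and "\<And>l. l \<in> set ls \<Longrightarrow> wr l \<in> snd ` set ls"
proof -
  define S where "S = reach P"
  define Q where "Q = insert Start (Pend ` S \<union> Done ` S)"
  \<comment> \<open>Only an \<open>Inc\<close> at the head of a residual program writes a nonblank
    symbol. The default 0 adds just \<open>Sym 1\<close>, which the input uses anyway.\<close>
  define R where "R = (\<lambda>q. case q of Inc r # k \<Rightarrow> r | _ \<Rightarrow> 0) ` S"
  define X where "X = insert Hash (Sym ` ({0, 1, 2} \<union> Suc ` R))"
  have fin: "finite (Q \<times> X)" by (simp add: Q_def X_def S_def R_def finite_reach)
  have P: "P \<in> S" "[] \<in> S" by (simp_all add: S_def reach_refl Nil_in_reach)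
  have cl: "\<And>r k. Inc r # k \<in> S \<Longrightarrow> k \<in> S" "\<And>r c k. Loop r c # k \<in> S \<Longrightarrow> k \<in> S"
    "\<And>r c k. Loop r c # k \<in> S \<Longrightarrow> c @ Loop r c # k \<in> S"
    using reach_Inc reach_Loop unfolding S_def by blast+
  have "set (init_letters P) \<subseteq> Q \<times> X"
    using P by (auto simp: init_letters_def Q_def X_def)
  obtain rest where rest: "set rest = Q \<times> X - set (init_letters P)" "distinct rest"
    using fin finite_distinct_list[of "Q \<times> X - set (init_letters P)"] by auto
  define ls where "ls = init_letters P @ rest"
  have set_ls: "set ls = Q \<times> X"
    using rest(1) \<open>set (init_letters P) \<subseteq> Q \<times> X\<close> by (auto simp: ls_def)
  have snd_ls: "snd ` set ls = X" unfolding set_ls by (auto simp: Q_def)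
  have "distinct ls" using rest by (auto simp: ls_def init_letters_def)
  moreover have "i < length ls \<and> ls ! i = init_letters P ! i" if "i < 5" for i
  proof -
    have "length (init_letters P) = 5" by (simp add: init_letters_def)
    then show ?thesis using that by (simp add: ls_def nth_append)
  qed
  moreover have "(nxt P l, x) \<in> set ls \<longleftrightarrow> x \<in> snd ` set ls" if l: "l \<in> set ls" for l x
  proof -
    have "nxt P l \<in> Q"
      using l P unfolding set_ls by (cases l rule: nxt.cases) (auto simp: Q_def dest: cl)
    then show ?thesis by (simp add: snd_ls) (simp add: set_ls)
  qed
  moreover have "wr l \<in> snd ` set ls" if l: "l \<in> set ls" for l
  proof (cases l rule: wr.cases)
    case (1 r k x)
    then have "Inc r # k \<in> S" using l by (auto simp: set_ls Q_def)
    then have "r \<in> R" unfolding R_def by force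
    then show ?thesis using l 1 by (auto simp: snd_ls set_ls X_def)
  qed (use l in \<open>auto simp: snd_ls set_ls X_def\<close>)
  ultimately show thesis using that by blast
qed

text \<open>A word that satisfies both formulas can only list the cells of the computation:
  \<open>nxt\<close> fixes each state from the preceding letter, \<open>wr\<close> each symbol from
  the letter one round earlier. This direction is asked only for tapes that hold the whole
  input.\<close>

lemma program_formula:
  obtains N \<theta> where "5 \<le> N" "letters \<theta> \<subseteq> {0..<N}"
    and "\<And>a b m. m > 0 \<Longrightarrow> \<exists>i. overflow (cell P m (initial_tape a b) i) \<Longrightarrow>
      \<exists>w\<in>words N (1 / real m). msat w 0 \<theta> \<and> msat w 0 (input_formula a b)"
    and "\<And>a b m w. a + b < m \<Longrightarrow> w \<in> words N (1 / real m) \<Longrightarrow> msat w 0 \<theta> \<Longrightarrow>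
      msat w 0 (input_formula a b) \<Longrightarrow> \<exists>i. overflow (cell P m (initial_tape a b) i)"
proof -
  obtain ls where distinct: "distinct ls"
    and init: "\<And>i. i < 5 \<Longrightarrow> i < length ls \<and> ls ! i = init_letters P ! i"
    and nxt_ls: "\<And>l x. l \<in> set ls \<Longrightarrow> (nxt P l, x) \<in> set ls \<longleftrightarrow> x \<in> snd ` set ls"
    and wr_ls: "\<And>l. l \<in> set ls \<Longrightarrow> wr l \<in> snd ` set ls"
    by (rule letter_table[where P = P]) blast
  define N where "N = length ls"
  define \<theta> where "\<theta> = tape_formula N (\<lambda>c. snd (ls ! c) = Hash)
    (\<lambda>c d. fst (ls ! d) = nxt P (ls ! c)) (\<lambda>c d. snd (ls ! d) = wr (ls ! c)) (\<lambda>c. overflow (ls ! c))"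
  have N: "5 \<le> N" using init[of 4] by (simp add: N_def)
  have ls0: "ls ! 0 = (Start, Hash)" "ls ! 1 = (Done P, Hash)"
    using init[of 0] init[of 1] by (simp_all add: init_letters_def)
  have \<theta>: "letters \<theta> \<subseteq> {0..<N}"
    unfolding \<theta>_def using N by (intro letters_tape_formula) simp
  have 1: "\<exists>w\<in>words N (1 / real m). msat w 0 \<theta> \<and> msat w 0 (input_formula a b)"
    if m: "m > 0" and ov: "overflow (cell P m (initial_tape a b) i)" for a b m i
  proof -
    let ?u = "initial_tape a b"
    let ?c = "cell P m ?u"
    have u: "?u 0 = Hash" "\<And>i. 0 < i \<Longrightarrow> i < m \<Longrightarrow> ?u i \<noteq> Hash" by (auto simp: initial_tape_def)
    have u_ls: "?u j \<in> snd ` set ls" for j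
    proof -
      have "init_letters P ! k \<in> set ls" if "k < 5" for k
        using init[OF that] nth_mem by metis
      from this[of 1] this[of 2] this[of 3] this[of 4] show ?thesis
        by (force simp: init_letters_def initial_tape_def numeral_eq_Suc)
    qed
    have c_ls: "?c j \<in> set ls" for j
    proof (induction j rule: less_induct)
      case (less j)
      have snd: "snd (?c j) \<in> snd ` set ls"
      proof (cases "j < m")
        case True
        then show ?thesis using u_ls by (simp add: snd_cell)
      next
        case False
        then have "snd (?c j) = wr (?c (j - m))"
          using snd_cell_add[OF m, of P ?u "j - m"] by simp
        then show ?thesis using less[of "j - m"] wr_ls False m by simp
      qed
      show ?case
      proof (cases j)
        case 0
        have "ls ! 0 \<in> set ls" using N unfolding N_def by (intro nth_mem) linarith
        then show ?thesis using 0 ls0 m u by (simp add: cell_0)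
      next
        case (Suc k)
        then have "?c j = (nxt P (?c k), snd (?c j))"
          by (metis fst_cell_Suc prod.collapse)
        then show ?thesis using less[of k] nxt_ls snd Suc by (metis lessI)
      qed
    qed
    define num where "num l = (SOME k. k < N \<and> ls ! k = l)" for l
    have num: "num l < N \<and> ls ! num l = l" if "l \<in> set ls" for l
    proof -
      have "\<exists>k. k < N \<and> ls ! k = l" using that by (auto simp: in_set_conv_nth N_def)
      then show ?thesis unfolding num_def by (rule someI_ex)
    qed
    have num_ls: "num (ls ! k) = k" if "k < N" for k
      using num[of "ls ! k"] that nth_mem[of k ls] nth_eq_iff_index_eq[OF distinct]
      unfolding N_def by blast
    \<comment> \<open>The word must contain the overflow at \<open>i\<close> and, for the input
      formula, the end of the tape at \<open>m\<close>.\<close>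
    define n where "n = Suc (max i m)"
    define w where "w = map (\<lambda>j. (num (?c j), real (Suc j) * (1 / real m))) [0..<n]"
    have len: "length w = n" by (simp add: w_def)
    have fw: "fst (w ! j) = num (?c j)" if "j < n" for j using that by (simp add: w_def)
    have fw': "ls ! fst (w ! j) = ?c j" if "j < n" for j using that num[OF c_ls] by (simp add: fw)
    have w: "w \<in> words N (1 / real m)"
      using num[OF c_ls] by (auto simp: words_def w_def n_def simp del: upt_Suc)
    have c0: "?c 0 = ls ! 0" using m u ls0 by (simp add: cell_0)
    have "i > 0" using ov c0 ls0 by (cases i) auto
    have "msat w 0 \<theta>"
      unfolding \<theta>_def msat_tape_formula[OF w m] len
    proof (intro conjI)
      show "fst (w ! 0) = 0" using num_ls[of 0] N c0 by (simp add: fw n_def)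
      show "\<forall>i. 0 < i \<and> i < m \<and> i < n \<longrightarrow> snd (ls ! fst (w ! i)) \<noteq> Hash"
        using u(2) by (simp add: fw' snd_cell)
      show "\<forall>i. Suc i < n \<longrightarrow> fst (ls ! fst (w ! Suc i)) = nxt P (ls ! fst (w ! i))"
        by (simp add: fw' fst_cell_Suc)
      show "\<forall>i. i + m < n \<longrightarrow> snd (ls ! fst (w ! (i + m))) = wr (ls ! fst (w ! i))"
        using m by (simp add: fw' snd_cell_add)
      show "\<exists>i>0. i < n \<and> overflow (ls ! fst (w ! i))"
        using ov \<open>i > 0\<close> by (intro exI[of _ i]) (simp add: fw' n_def)
    qed
    moreover have "msat w 0 (input_formula a b)"
    proof (rule input_formulaI[OF w _ m, where ls = ls and P = P])
      have Done: "fst (?c (Suc j)) = Done P" if "Suc j \<le> m" for j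
        using that
      proof (induction j)
        case 0
        then show ?case using c0 ls0 by (simp add: fst_cell_Suc)
      next
        case (Suc j)
        then obtain y where "?c (Suc j) = (Done P, Sym y)"
          using u(2)[of "Suc j"] snd_cell[of "Suc j" m P ?u]
          by (cases "?u (Suc j)") (auto simp: prod_eq_iff)
        then show ?case by (simp add: fst_cell_Suc)
      qed
      show "m < length w" by (simp add: len n_def)
      have "?c m = (Done P, Hash)"
        using Done[of "m - 1"] snd_cell_add[OF m, of P ?u 0] c0 ls0 m by (simp add: prod_eq_iff)
      then show "fst (w ! m) = 1" using num_ls[of 1] N ls0 by (simp add: fw n_def)
      show "fst (w ! j) < length ls \<and> ls ! fst (w ! j) = (Done P, initial_tape a b j)"
        if "0 < j" "j < m" for j
      proof -
        have "?c j = (Done P, ?u j)" using Done[of "j - 1"] that by (simp add: prod_eq_iff snd_cell)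
        then show ?thesis using that num[OF c_ls, of j] by (simp add: fw n_def N_def)
      qed
    qed (use distinct init in auto)
    ultimately show ?thesis using w by blast
  qed
  have 2: "\<exists>i. overflow (cell P m (initial_tape a b) i)"
    if m: "a + b < m" and w: "w \<in> words N (1 / real m)" and "msat w 0 \<theta>"
      and inp: "msat w 0 (input_formula a b)" for a b m w
  proof -
    let ?u = "initial_tape a b"
    let ?c = "cell P m ?u"
    have m0: "m > 0" using m by simp
    have W: "fst (w ! 0) = 0"
      "\<And>i. 0 < i \<Longrightarrow> i < m \<Longrightarrow> i < length w \<Longrightarrow> snd (ls ! fst (w ! i)) \<noteq> Hash"
      "\<And>i. Suc i < length w \<Longrightarrow> fst (ls ! fst (w ! Suc i)) = nxt P (ls ! fst (w ! i))"
      "\<And>i. i + m < length w \<Longrightarrow> snd (ls ! fst (w ! (i + m))) = wr (ls ! fst (w ! i))"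
      "\<exists>i>0. i < length w \<and> overflow (ls ! fst (w ! i))"
      using that(3) unfolding \<theta>_def msat_tape_formula[OF w m0] by auto
    have no: "fst (w ! j) \<noteq> 1" if "0 < j" "j < m" "j < length w" for j
      using W(2)[OF that] ls0 by auto
    have u: "snd (ls ! fst (w ! j)) = ?u j" if "0 < j" "j < m" for j
      using input_formulaD[OF w _ inp no m that, of P] init[of "fst (w ! j)"] by auto
    have "ls ! fst (w ! j) = ?c j" if "j < length w" for j
      using that
    proof (induction j rule: less_induct)
      case (less j)
      have fst: "fst (ls ! fst (w ! j)) = fst (?c j)"
        using less.IH[of "j - 1"] less.prems W(1) W(3)[of "j - 1"] fst_cell_Suc[of P m ?u "j - 1"] ls0 m0
        by (cases j) (auto simp: cell_0)
      have snd: "snd (ls ! fst (w ! j)) = snd (?c j)"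
      proof (cases "j < m")
        case True
        then show ?thesis using u[of j] W(1) ls0 m0
          by (cases "j = 0") (auto simp: snd_cell initial_tape_def)
      next
        case False
        then show ?thesis using less.IH[of "j - m"] less.prems W(4)[of "j - m"] m0
            snd_cell_add[OF m0, of P ?u "j - m"] by simp
      qed
      from fst snd show ?case by (rule prod_eqI)
    qed
    with W(5) show ?thesis by metis
  qed
  show thesis using that N \<theta> 1 2 by blast
qed

text \<open>Each turn takes three steps, one decrement and two increments, with a net gain of
  one.\<close>

lemma grows:
  "\<exists>n. (step ^^ n) ([Loop 2 [Inc 2, Inc 2]], s(2 := 1)) = ([Loop 2 [Inc 2, Inc 2]], s(2 := Suc j))"
proof (induction j)
  case 0
  show ?case by (rule exI[of _ 0]) simp
next
  case (Suc j)
  let ?L = "[Loop 2 [Inc 2, Inc 2]]"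
  obtain n where n: "(step ^^ n) (?L, s(2 := 1)) = (?L, s(2 := Suc j))"
    using Suc by blast
  have "(step ^^ 3) (?L, s(2 := Suc j)) = (?L, s(2 := Suc (Suc j)))"
    by (simp add: numeral_3_eq_3)
  from funpow_trans[OF n this] show ?case by blast
qed

text \<open>The program computes \<open>f\<close> and then, if the result is 1, increments a register forever,
  which overflows on every tape; otherwise it halts, and every longer tape is sufficient.\<close>

lemma decision_formula:
  obtains N \<theta> where "5 \<le> N" "letters \<theta> \<subseteq> {0..<N}"
    and "\<And>a b m. m > 0 \<Longrightarrow> rec_eval f [a, b] 1 \<Longrightarrow>
      \<exists>w\<in>words N (1 / real m). msat w 0 \<theta> \<and> msat w 0 (input_formula a b)"
    and "\<And>a b. rec_eval f [a, b] 0 \<Longrightarrow>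
      \<exists>m>0. \<forall>w\<in>words N (1 / real m). \<not> (msat w 0 \<theta> \<and> msat w 0 (input_formula a b))"
proof -
  obtain C where C: "\<And>s y. \<forall>r\<ge>4. s r = 0 \<Longrightarrow> rec_eval f (map s [0, 1]) y \<Longrightarrow> runs C s (s(2 := y))"
    by (rule programmableE[OF programmable[of f], of "[0, 1]" 4 2]) auto
  let ?L = "[Loop 2 [Inc 2, Inc 2]]"
  \<comment> \<open>The leading \<open>Inc 3\<close> serves \<open>overflow_full\<close>; register 3
    is neither an argument, nor the result, nor scratch space of \<open>C\<close>.\<close>
  define P where "P = Inc 3 # C @ ?L"
  obtain N \<theta> where N: "5 \<le> N" "letters \<theta> \<subseteq> {0..<N}"
    and 1: "\<And>a b m. m > 0 \<Longrightarrow> \<exists>i. overflow (cell P m (initial_tape a b) i) \<Longrightarrow>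
      \<exists>w\<in>words N (1 / real m). msat w 0 \<theta> \<and> msat w 0 (input_formula a b)"
    and 2: "\<And>a b m w. a + b < m \<Longrightarrow> w \<in> words N (1 / real m) \<Longrightarrow> msat w 0 \<theta> \<Longrightarrow>
      msat w 0 (input_formula a b) \<Longrightarrow> \<exists>i. overflow (cell P m (initial_tape a b) i)"
    by (rule program_formula[of P]) blast
  define s0 :: "nat \<Rightarrow> nat \<Rightarrow> nat \<Rightarrow> nat" where "s0 a b = (\<lambda>_. 0)(0 := a, 1 := b)" for a b
  have run: "\<exists>n. (step ^^ n) (P, s0 a b) = (?L, (s0 a b)(3 := 1, 2 := y))"
    if "rec_eval f [a, b] y" for a b y
  proof -
    have "runs C ((s0 a b)(3 := 1)) ((s0 a b)(3 := 1, 2 := y))"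
      using that by (intro C) (auto simp: s0_def)
    then obtain n where 2: "(step ^^ n) (C @ ?L, (s0 a b)(3 := 1)) = (?L, (s0 a b)(3 := 1, 2 := y))"
      unfolding runs_def by blast
    have 1: "(step ^^ 1) (P, s0 a b) = (C @ ?L, (s0 a b)(3 := 1))"
      by (simp add: P_def s0_def)
    show ?thesis using funpow_trans[OF 1 2] by blast
  qed
  have tape: "initial_tape a b 0 = Hash" "\<And>i. 0 < i \<Longrightarrow> initial_tape a b i \<noteq> Hash" for a b
    by (auto simp: initial_tape_def)
  have "\<exists>w\<in>words N (1 / real m). msat w 0 \<theta> \<and> msat w 0 (input_formula a b)"
    if m: "m > 0" and f: "rec_eval f [a, b] 1" for a b m
  proof (rule 1[OF m])
    show "\<exists>i. overflow (cell P m (initial_tape a b) i)"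
    proof (cases "a + b < m")
      case True
      obtain n where "(step ^^ n) (P, s0 a b) = (?L, (s0 a b)(3 := 1, 2 := 1))"
        using run[OF f] by blast
      moreover obtain n' where "(step ^^ n') (?L, (s0 a b)(3 := 1, 2 := 1)) =
          (?L, (s0 a b)(3 := 1, 2 := Suc m))"
        using grows[of "(s0 a b)(3 := 1)" m] by blast
      ultimately have *: "(step ^^ (n' + n)) (P, s0 a b) = (?L, (s0 a b)(3 := 1, 2 := Suc m))"
        by (rule funpow_trans)
      show ?thesis
      proof (rule overflowI[where u = "initial_tape a b", OF m tape])
        show "count_list (row P m (initial_tape a b) 0) (Sym (Suc r)) = s0 a b r" for r
          unfolding s0_def by (rule initial_row(1)[OF True])
        show "m \<le> snd ((step ^^ (n' + n)) (P, s0 a b)) 2" unfolding * by simp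
      qed
    next
      case False
      then show ?thesis
        using m initial_row_full by (intro overflow_full[where u = "initial_tape a b", OF m tape P_def]) auto
    qed
  qed
  moreover have "\<exists>m>0. \<forall>w\<in>words N (1 / real m). \<not> (msat w 0 \<theta> \<and> msat w 0 (input_formula a b))"
    if f: "rec_eval f [a, b] 0" for a b
  proof -
    obtain n where n: "(step ^^ n) (P, s0 a b) = (?L, (s0 a b)(3 := 1, 2 := 0))"
      using run[OF f] by blast
    have "(step ^^ 1) (?L, (s0 a b)(3 := 1, 2 := 0)) = ([], (s0 a b)(3 := 1, 2 := 0))" by simp
    from funpow_trans[OF n this]
    have halt: "(step ^^ (1 + n)) (P, s0 a b) = ([], (s0 a b)(3 := 1, 2 := 0))" .
    \<comment> \<open>This leaves \<open>n + 2\<close> blanks behind the input, more than the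
      \<open>1 + n\<close> steps of the run.\<close>
    define m where "m = a + b + n + 3"
    have m: "m > 0" "a + b < m" by (simp_all add: m_def)
    have "\<not> overflow (cell P m (initial_tape a b) i)" for i
    proof (rule not_overflowI[where u = "initial_tape a b", OF m(1) tape _ halt])
      show "count_list (row P m (initial_tape a b) 0) (Sym (Suc r)) = s0 a b r" for r
        unfolding s0_def by (rule initial_row(1)[OF m(2)])
      show "1 + n < count_list (row P m (initial_tape a b) 0) (Sym 0)"
        unfolding initial_row(2)[OF m(2)] by (simp add: m_def)
    qed
    then show ?thesis using m 2 by blast
  qed
  ultimately show thesis using that N by blast
qed


section \<open>The automaton and the diagonal argument\<close>

definition ticks :: "nat \<Rightarrow> npta" where
  "ticks N = \<lparr>alphabet = {0..<N}, locs = {0}, initials = {0}, clocks = {0}, params = {0},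
     edges = (\<lambda>a. (0, a, [(0, Eq, Param 0)], {0}, 0)) ` {0..<N}, finals = {0}\<rparr>"

lemma ticks_instance:
  assumes "letters \<phi> \<subseteq> {0..<N}"
  shows "(ticks N, \<phi>) \<in> det_1clock_1param_instances"
  using assms unfolding det_1clock_1param_instances_def mc_instances_def
  by (auto simp: is_pta_def deterministic_def ticks_def guards_def)

lemma edges_ticks:
  "(l, a, g, r, l') \<in> edges (ticks N) \<longleftrightarrow>
    l = 0 \<and> a < N \<and> g = [(0, Eq, Param 0)] \<and> r = {0} \<and> l' = 0"
  by (auto simp: ticks_def)

lemma transition_ticks:
  "transition (ticks N) v (l, \<nu>) (a, \<delta>) (l', \<nu>') \<longleftrightarrow>
    l = 0 \<and> l' = 0 \<and> a < N \<and> 0 \<le> \<delta> \<and> \<nu> 0 + \<delta> = of_rat (v 0) \<and> \<nu>' = reset (delay \<nu> \<delta>) {0}"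
  by (auto simp: edges_ticks guard_sat_def delay_def)

text \<open>Every loop resets the clock, so \<open>\<nu> 0 = 0\<close> is preserved and each delay
  is forced to be the parameter value.\<close>

lemma run_ticks:
  assumes "0 \<le> v 0" "\<nu> 0 = 0"
  shows "(\<exists>\<nu>'. run (ticks N) v (0, \<nu>) ss (0, \<nu>')) \<longleftrightarrow> (\<forall>(a, \<delta>)\<in>set ss. a < N \<and> \<delta> = of_rat (v 0))"
  using assms(2)
proof (induction ss arbitrary: \<nu>)
  case (Cons s ss)
  obtain a \<delta> where s: "s = (a, \<delta>)" by (cases s)
  have IH: "(\<exists>\<nu>'. run (ticks N) v (0, reset (delay \<nu> \<delta>) {0}) ss (0, \<nu>')) \<longleftrightarrow>
      (\<forall>(a, \<delta>)\<in>set ss. a < N \<and> \<delta> = of_rat (v 0))"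
    by (rule Cons.IH) (simp add: reset_def)
  have "(\<exists>\<nu>'. run (ticks N) v (0, \<nu>) (s # ss) (0, \<nu>')) \<longleftrightarrow>
    a < N \<and> \<delta> = of_rat (v 0) \<and> (\<exists>\<nu>'. run (ticks N) v (0, reset (delay \<nu> \<delta>) {0}) ss (0, \<nu>'))"
    using Cons.prems assms(1) by (auto simp: s transition_ticks simp del: transition.simps)
  then show ?case unfolding IH by (auto simp: s)
qed auto

lemma lang_ticks:
  assumes "0 \<le> v 0"
  shows "lang (ticks N) v = words N (of_rat (v 0))"
proof (intro set_eqI iffI)
  let ?p = "of_rat (v 0) :: real"
  have successful: "successful (ticks N) v ss \<longleftrightarrow> (\<forall>(a, \<delta>)\<in>set ss. a < N \<and> \<delta> = ?p)" for ss
    using run_ticks[of v "\<lambda>_. 0" N ss] assms by (simp add: successful_def ticks_def)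
  have word_of: "length (word_of ss) = length ss" for ss :: "(nat \<times> real) list"
    by (simp add: word_of_def)
  have nth: "word_of ss ! i = (fst (ss ! i), real (Suc i) * ?p)"
    if "\<forall>(a, \<delta>)\<in>set ss. a < N \<and> \<delta> = ?p" "i < length ss" for ss :: "(nat \<times> real) list" and i
  proof -
    have "snd (ss ! j) = ?p" if "j \<le> i" for j
      using \<open>\<forall>(a, \<delta>)\<in>set ss. a < N \<and> \<delta> = ?p\<close> \<open>i < length ss\<close> that nth_mem[of j ss]
      by (auto simp: case_prod_beta)
    then have "(\<Sum>j\<le>i. snd (ss ! j)) = (\<Sum>j\<le>i. ?p)" by (intro sum.cong) auto
    then show ?thesis using that(2) by (simp add: word_of_def)
  qed
  fix w
  show "w \<in> words N ?p" if w: "w \<in> lang (ticks N) v"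
  proof -
    obtain ss where ss: "\<forall>(a, \<delta>)\<in>set ss. a < N \<and> \<delta> = ?p" "w = word_of ss" and "w \<noteq> []"
      using w by (auto simp: lang_def successful timed_word_def)
    have "fst (ss ! i) < N" if "i < length ss" for i
      using ss(1) nth_mem[OF that] by (auto simp: case_prod_beta)
    then show ?thesis using \<open>w \<noteq> []\<close> nth[OF ss(1)] unfolding words_def by (auto simp: ss(2) word_of)
  qed
  show "w \<in> lang (ticks N) v" if w: "w \<in> words N ?p"
  proof -
    have W: "w \<noteq> []" "\<And>i. i < length w \<Longrightarrow> fst (w ! i) < N"
      "\<And>i. i < length w \<Longrightarrow> snd (w ! i) = real (Suc i) * ?p"
      using w by (auto simp: words_def)
    define ss where "ss = map (\<lambda>(a, t). (a, ?p)) w"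
    have ss: "\<forall>(a, \<delta>)\<in>set ss. a < N \<and> \<delta> = ?p"
      using W(2) by (auto simp: ss_def in_set_conv_nth) (metis fst_conv)
    have "w = word_of ss"
    proof (rule nth_equalityI)
      show "length w = length (word_of ss)" by (simp add: word_of) (simp add: ss_def)
      show "w ! i = word_of ss ! i" if "i < length w" for i
        using nth[OF ss, of i] W(3)[OF that] that
        by (simp add: ss_def prod_eq_iff case_prod_beta)
    qed
    moreover have "timed_word w"
      unfolding timed_word_def
    proof (intro conjI)
      show "sorted (map snd w)"
        using W(3) assms by (auto simp: sorted_iff_nth_mono intro!: mult_right_mono)
      have "0 \<le> snd x" if "x \<in> set w" for x
        using that W(3) assms by (auto simp: in_set_conv_nth)
      then show "\<forall>(a, t)\<in>set w. 0 \<le> t" by auto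
    qed (rule W(1))
    ultimately show ?thesis using ss by (auto simp: lang_def successful)
  qed
qed

text \<open>Parameter values that are not of the form \<open>1 / m\<close> must violate the specification
  as well; this formula is true of all long words for such a value.\<close>

definition misaligned :: "nat mtl" where
  "misaligned = Disj (Ev (Ivl (Incl 0) (Some (Incl 0))) Tru)
     (Conj (Neg (Ev unit_ivl Tru)) (Ev (Ivl (Incl 1) None) Tru))"

text \<open>Consecutive events are \<open>1 / m\<close> apart: an event at distance at least 1 has
  index at least \<open>m\<close>, so the event with index \<open>m\<close> exists, at distance
  exactly 1.\<close>

lemma not_misaligned:
  assumes w: "w \<in> words N (1 / real m)" and m: "m > 0"
  shows "\<not> msat w 0 misaligned"
proof -
  have "\<not> msat w 0 (Ev (Ivl (Incl 0) (Some (Incl 0))) Tru)"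
    using m by (auto simp: msat_Ev[OF w] field_simps)
  moreover have "msat w 0 (Ev unit_ivl Tru)" if late: "msat w 0 (Ev (Ivl (Incl 1) None) Tru)"
  proof -
    obtain j where "j < length w" "1 \<le> real j * (1 / real m)"
      using late by (auto simp: msat_Ev[OF w])
    then have "m < length w" using m by (simp add: field_simps)
    then show ?thesis by (simp add: msat_Ev_unit[OF w m])
  qed
  ultimately show ?thesis by (auto simp: misaligned_def)
qed

text \<open>For \<open>p = 0\<close> all events coincide. Otherwise a long word passes distance 1,
  while an event at distance exactly 1 would give \<open>j * p = 1\<close> and thus
  \<open>p = 1 / j\<close>.\<close>

lemma misaligned:
  assumes p: "p \<ge> 0" "\<And>m. m > 0 \<Longrightarrow> p \<noteq> 1 / real m" and N: "N > 0"
  shows "\<exists>w\<in>words N p. msat w 0 misaligned"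
proof -
  obtain n :: nat where n: "p > 0 \<Longrightarrow> 1 < real n * p"
    using reals_Archimedean3[of p] by blast
  \<comment> \<open>Index \<open>n\<close> lies beyond distance 1 if \<open>p > 0\<close>; length
    \<open>n + 2\<close> also provides index 1 when \<open>n = 0\<close>.\<close>
  define w :: "nat tword" where "w = map (\<lambda>i. (0, real (Suc i) * p)) [0..<n + 2]"
  have w: "w \<in> words N p" using N by (auto simp: w_def words_def simp del: upt_Suc)
  have len: "length w = n + 2" by (simp add: w_def)
  have "msat w 0 misaligned"
  proof (cases "p = 0")
    case True
    then have "msat w 0 (Ev (Ivl (Incl 0) (Some (Incl 0))) Tru)"
      by (auto simp: msat_Ev[OF w] len intro!: exI[of _ 1])
    then show ?thesis by (simp add: misaligned_def)
  next
    case False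
    then have "1 < real n * p" "n > 0" using p n by (auto intro: Suc_leI gr0I)
    then have "msat w 0 (Ev (Ivl (Incl 1) None) Tru)"
      by (auto simp: msat_Ev[OF w] len intro!: exI[of _ n])
    moreover have "\<not> msat w 0 (Ev unit_ivl Tru)"
    proof
      assume "msat w 0 (Ev unit_ivl Tru)"
      then obtain j where "j > 0" "real j * p = 1"
        by (auto simp: msat_Ev[OF w] unit_ivl_def)
      then show False using p(2)[of j] by (simp add: field_simps)
    qed
    ultimately show ?thesis by (simp add: misaligned_def)
  qed
  with w show ?thesis by blast
qed

lemma letters_misaligned: "letters misaligned = {0}"
  by (simp add: misaligned_def letters_basic)

text \<open>The first conjunct defeats parameter values not of the form \<open>1 / m\<close>; the
  second denies that the word is an overflowing computation on \<open>(a, b)\<close>. A good value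
  thus amounts to a tape length without overflow.\<close>

definition spec :: "nat mtl \<Rightarrow> nat \<Rightarrow> nat \<Rightarrow> nat mtl" where
  "spec \<theta> a b = Conj (Neg misaligned) (Neg (Conj \<theta> (input_formula a b)))"

definition load_code :: "nat \<Rightarrow> nat \<Rightarrow> nat" where
  "load_code c x = list_encode [3, ivl_code (Ivl (Incl 0) None), mtl_code (Neg Tru),
     list_encode [1, list_encode [2, mtl_code (Neg (Letter 1)),
       list_encode [1, list_encode [2, mtl_code (Letter c), x]]]]]"

lemma mtl_code_load: "mtl_code ((load c ^^ n) \<phi>) = (load_code c ^^ n) (mtl_code \<phi>)"
proof (induction n)
  case (Suc n)
  have "mtl_code (load c \<phi>) = load_code c (mtl_code \<phi>)" for \<phi>
    unfolding load_def load_code_def Next_def Disj_def by (simp only: mtl_code.simps)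
  with Suc show ?case by simp
qed simp

lemma recursive_load_code: "recursive n h \<Longrightarrow> recursive n (\<lambda>xs. load_code c (h xs))"
  unfolding load_code_def by (intro recursive_intros)

text \<open>This is the self-reference: the code of an instance that has the codes of
  \<open>A\<close> and \<open>\<theta>\<close> as its input is computed from these codes, without
  decoding them. The input formula enters through iterated \<open>load_code\<close>.\<close>

lemma recursive_instance_code:
  obtains h where "\<And>A \<theta>. instance_code (A, spec \<theta> (pta_code A) (mtl_code \<theta>)) = h [pta_code A, mtl_code \<theta>]"
    and "recursive 2 h"
proof -
  define c where "c = mtl_code (Until (Ivl (Incl 0) None) (Letter 4) (Letter 1))"
  define h where "h xs = prod_encode (xs ! 0, list_encode [2, mtl_code (Neg misaligned),
    list_encode [1, list_encode [2, xs ! 1,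
      (load_code 2 ^^ (xs ! 0)) ((load_code 3 ^^ (xs ! 1)) c)]]])" for xs
  have "recursive 2 h"
    unfolding h_def by (intro recursive_intros recursive_load_code) simp_all
  moreover have "instance_code (A, spec \<theta> (pta_code A) (mtl_code \<theta>)) = h [pta_code A, mtl_code \<theta>]" for A \<theta>
    by (simp only: instance_code.simps spec_def mtl_code.simps input_formula_def mtl_code_load h_def c_def
      nth_Cons_0 nth_Cons_Suc One_nat_def)
  ultimately show thesis using that by blast
qed

lemma undecidable:
  "\<not> decidable_on instance_code det_1clock_1param_instances mc_holds"
proof
  assume "decidable_on instance_code det_1clock_1param_instances mc_holds"
  then obtain f where f: "\<And>i. i \<in> det_1clock_1param_instances \<Longrightarrow>
      rec_eval f [instance_code i] (if mc_holds i then 1 else 0)"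
    unfolding decidable_on_def by blast
  obtain h where h: "\<And>A \<theta>. instance_code (A, spec \<theta> (pta_code A) (mtl_code \<theta>)) = h [pta_code A, mtl_code \<theta>]"
    and "recursive 2 h"
    by (rule recursive_instance_code) blast
  then obtain g where g: "\<And>xs. length xs = 2 \<Longrightarrow> rec_eval g xs (h xs)"
    unfolding recursive_def by blast
  obtain N \<theta> where N: "5 \<le> N" and \<theta>: "letters \<theta> \<subseteq> {0..<N}"
    and 1: "\<And>a b m. m > 0 \<Longrightarrow> rec_eval (Comp f [g]) [a, b] 1 \<Longrightarrow>
      \<exists>w\<in>words N (1 / real m). msat w 0 \<theta> \<and> msat w 0 (input_formula a b)"
    and 0: "\<And>a b. rec_eval (Comp f [g]) [a, b] 0 \<Longrightarrow>
      \<exists>m>0. \<forall>w\<in>words N (1 / real m). \<not> (msat w 0 \<theta> \<and> msat w 0 (input_formula a b))"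
    by (rule decision_formula[of "Comp f [g]"]) blast
  \<comment> \<open>The diagonal: \<open>\<theta>\<close> was built from \<open>f\<close> and
    \<open>g\<close> for all inputs at once, so its own code can now be the input.\<close>
  define a b where "a = pta_code (ticks N)" and "b = mtl_code \<theta>"
  define \<phi> where "\<phi> = spec \<theta> a b"
  have "letters \<phi> \<subseteq> {0..<N}"
    using N \<theta> letters_input_formula[of a b] by (auto simp: \<phi>_def spec_def letters_misaligned)
  from f[OF ticks_instance[OF this]]
  have "rec_eval f [h [a, b]] (if mc_holds (ticks N, \<phi>) then 1 else 0)"
    by (simp only: h \<phi>_def a_def b_def)
  then have eval: "rec_eval (Comp f [g]) [a, b] (if mc_holds (ticks N, \<phi>) then 1 else 0)"
    by (intro rec_eval.comp[where ys = "[h [a, b]]"]) (simp_all add: g)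
  have "params (ticks N) = {0}" by (simp add: ticks_def)
  then have mc: "mc_holds (ticks N, \<phi>) \<longleftrightarrow>
      (\<exists>v :: nat \<Rightarrow> rat. 0 \<le> v 0 \<and> (\<forall>w\<in>words N (of_rat (v 0)). msat w 0 \<phi>))"
    unfolding mc_holds_def
    by (auto simp: param_valuation_def models_def lang_ticks)
  show False
  proof (cases "mc_holds (ticks N, \<phi>)")
    case True
    then obtain v where *: "0 \<le> v 0 \<and> (\<forall>w\<in>words N (of_rat (v 0)). msat w 0 \<phi>)"
      unfolding mc ..
    then have v: "0 \<le> v 0" and all: "\<And>w. w \<in> words N (of_rat (v 0)) \<Longrightarrow> msat w 0 \<phi>"
      by simp_all
    \<comment> \<open>The answer 1 makes the program overflow on every tape, so each value
      \<open>1 / m\<close> has a word violating \<open>\<phi>\<close>; all other values are refuted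
      by \<open>misaligned\<close>.\<close>
    have "\<exists>w\<in>words N (of_rat (v 0)). \<not> msat w 0 \<phi>"
    proof (cases "\<exists>m>0. of_rat (v 0) = 1 / real m")
      case aligned: True
      then obtain m where "m > 0" "of_rat (v 0) = 1 / real m" by blast
      then show ?thesis using 1[of m a b] eval True by (auto simp: \<phi>_def spec_def)
    next
      case False
      have "\<exists>w\<in>words N (of_rat (v 0)). msat w 0 misaligned"
      proof (rule misaligned)
        show "of_rat (v 0) \<noteq> 1 / real m" if "m > 0" for m using False that by blast
      qed (use v N in simp_all)
      then show ?thesis by (auto simp: \<phi>_def spec_def)
    qed
    with all show False by blast
  next
    case False
    with 0[of a b] eval obtain m where m: "m > 0"
      "\<And>w. w \<in> words N (1 / real m) \<Longrightarrow> \<not> (msat w 0 \<theta> \<and> msat w 0 (input_formula a b))"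
      by auto
    \<comment> \<open>The answer 0 makes the program halt, and a tape length \<open>m\<close>
      without overflow yields the rational parameter value \<open>1 / m\<close>.\<close>
    have "of_rat (1 / of_nat m) = 1 / real m" by (simp add: of_rat_divide)
    moreover have "\<forall>w\<in>words N (1 / real m). msat w 0 \<phi>"
      using m not_misaligned by (auto simp: \<phi>_def spec_def)
    ultimately have "mc_holds (ticks N, \<phi>)"
      unfolding mc by (intro exI[of _ "\<lambda>_. 1 / of_nat m"]) simp
    with False show False ..
  qed
qed

theorem theorem1:
  "\<not> decidable_on instance_code mc_instances mc_holds \<and>
   \<not> decidable_on instance_code det_1clock_1param_instances mc_holds"
proof -
  have "det_1clock_1param_instances \<subseteq> mc_instances"
    by (auto simp: det_1clock_1param_instances_def)
  then have "decidable_on instance_code mc_instances mc_holds \<Longrightarrow>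
      decidable_on instance_code det_1clock_1param_instances mc_holds"
    unfolding decidable_on_def by blast
  with undecidable show ?thesis by blast
qed

end
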